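(* Let $a<-1$ and let $f$ and $\Omega$ be as in the context; let $\mathrm{dist}$ be a distance function inducing the topology of $\overline{\mathbf R^2}$. There is an $\eta>0$ such that if $p,q\in\Omega\cap\mathbf R^2$ are distinct points, then $\sup_{n\in\mathbf Z}\mathrm{dist}(f^n p,f^n q)>\eta$.
   Context: Fix a real number $a<-1$. Let $\overline{\mathbf R^2}=(\mathbf R\cup\{\infty\})\times(\mathbf R\cup\{\infty\})$ (a compact torus, $+\infty$ and $-\infty$ identified to $\infty$ in each factor). The birational map $f(x,y)=\left(y\frac{x+a}{x-1},\,x+a-1\right)$, with inverse $f^{-1}(x,y)=\left(y+1-a,\,x\frac{y-a}{y+1}\right)$, extends continuously to $\overline{\mathbf R^2}\setminus I(f)$, resp. $\overline{\mathbf R^2}\setminus I(f^{-1})$, where $I(f)=\{(1,0),(-a,\infty)\}$ and $I(f^{-1})=\{(0,-1),(\infty,a)\}$. On the lines at infinity, $f(\infty,y)=(y,\infty)$ and $f(x,\infty)=(\infty,x+a-1)$. All iterates $f^n$, $n\in\mathbf Z$, are well defined at points of $\Omega\cap\mathbf R^2$ (though the orbit may leave $\mathbf R^2$). Rectangles: $R_0=[1,\infty]\times[-\infty,-1]$ and $R_1=[-\infty,0]\times[0,\infty]$. Words: $\Sigma\subset\{0,1\}^{\mathbf Z}$ is the set of bi-infinite sequences in which the block $11$ does not occur. For a finite block $w=w_{-n}\dots w_m$ ($n,m\ge0$) occurring in an element of $\Sigma$, $R(w)=\overline{\bigcap_{k=-n}^{m}f^{-k}(\operatorname{int}R_{w_k})}$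 (images under iterates of $f^{\pm1}$; no point of $\operatorname{int}R_0\cup\operatorname{int}R_1$ is indeterminate for any iterate). For $w\in\Sigma$, $R(w)=\bigcap_{n,m\ge0}R(w_{-n}\dots w_m)$. Set $\Omega=\bigcup_{w\in\Sigma}R(w)$. *)

theory Defs
  imports "HOL-Analysis.Analysis"
begin

text \<open>
  A point of the torus is a pair of elements of the one-point compactification of the real line;
  \<open>Some x\<close> is the real number \<open>x\<close>, and \<open>None\<close> is the point at infinity.
\<close>

type_synonym torus = "real option \<times> real option"

definition torus_top :: "torus topology" where
  "torus_top = prod_topology (Alexandroff_compactification euclideanreal)
                             (Alexandroff_compactification euclideanreal)"

definition affine_pts :: "torus set" where
  "affine_pts = range Some \<times> range Some"

text \<open>
  \<open>bir a\<close> and \<open>bir_inv a\<close> are the continuous extensions (for \<open>a < -1\<close>) of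
  \<open>(x, y) \<mapsto> (y * (x + a) / (x - 1), x + a - 1)\<close> and of its inverse
  \<open>(x, y) \<mapsto> (y + 1 - a, x * (y - a) / (y + 1))\<close>. They are unspecified exactly at the
  indeterminacy points \<open>(1, 0)\<close>, \<open>(-a, \<infinity>)\<close> and \<open>(0, -1)\<close>, \<open>(\<infinity>, a)\<close> respectively.
\<close>

fun bir :: "real \<Rightarrow> torus \<Rightarrow> torus" where
  "bir a (Some x, Some y) =
     (if x \<noteq> 1 then (Some (y * (x + a) / (x - 1)), Some (x + a - 1))
      else if y \<noteq> 0 then (None, Some (x + a - 1)) else undefined)"
| "bir a (Some x, None) = (if x \<noteq> -a then (None, Some (x + a - 1)) else undefined)"
| "bir a (None, y) = (y, None)"

fun bir_inv :: "real \<Rightarrow> torus \<Rightarrow> torus" where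
  "bir_inv a (Some x, Some y) =
     (if y \<noteq> -1 then (Some (y + 1 - a), Some (x * (y - a) / (y + 1)))
      else if x \<noteq> 0 then (Some (y + 1 - a), None) else undefined)"
| "bir_inv a (None, Some y) = (if y \<noteq> a then (Some (y + 1 - a), None) else undefined)"
| "bir_inv a (x, None) = (None, x)"

definition bir_iter :: "real \<Rightarrow> int \<Rightarrow> torus \<Rightarrow> torus" where
  "bir_iter a n = (if n \<ge> 0 then bir a ^^ nat n else bir_inv a ^^ nat (- n))"

text \<open>
  Both ends of an interval such as \<open>[1, \<infinity>]\<close> or \<open>[-\<infinity>, 0]\<close> that are infinite denote
  the same point \<open>None\<close>.
\<close>

definition Rect :: "nat \<Rightarrow> torus set" where
  "Rect i = (if i = 0 then insert None (Some ` {1..}) \<times> insert None (Some ` {..-1})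
                      else insert None (Some ` {..0}) \<times> insert None (Some ` {0..}))"

definition words :: "(int \<Rightarrow> nat) set" where
  "words = {w. range w \<subseteq> {0, 1} \<and> \<not> (\<exists>i. w i = 1 \<and> w (i + 1) = 1)}"

text \<open>
  \<open>Rect_block a w n m\<close> is the set attached to the finite block \<open>w (-n) \<dots> w m\<close>. As in the
  source, \<open>f\<^sup>-\<^sup>k\<close> of a set is its image under the iterate of order \<open>-k\<close>.
\<close>

definition Rect_block :: "real \<Rightarrow> (int \<Rightarrow> nat) \<Rightarrow> nat \<Rightarrow> nat \<Rightarrow> torus set" where
  "Rect_block a w n m =
     torus_top closure_of
       (\<Inter>k\<in>{- int n..int m}. bir_iter a (- k) ` (torus_top interior_of Rect (w k)))"

definition Rect_word :: "real \<Rightarrow> (int \<Rightarrow> nat) \<Rightarrow> torus set" where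
  "Rect_word a w = (\<Inter>n. \<Inter>m. Rect_block a w n m)"

definition Omega :: "real \<Rightarrow> torus set" where
  "Omega a = (\<Union>w\<in>words. Rect_word a w)"

end

theory Submission
  imports Defs
begin

text \<open>
  Every point of \<open>\<Omega> \<inter> \<real>\<^sup>2\<close> has a word in \<open>words\<close>: its iterates of order \<open>n\<close> lie in the
  rectangle of the \<open>n\<close>-th letter. Expansivity splits into two statements.

    \<^item> A word belongs to at most one affine point (\<open>affine_word_unique\<close>).

    \<^item> Points with different words separate by a fixed amount. The two rectangles meet only at
      \<open>(\<infinity>, \<infinity>)\<close>, so as long as two orbits stay close, the places where their words differ occur
      near \<open>(\<infinity>, \<infinity>)\<close>. There the map alternates between the rectangles, so the words differ at all
      times and both alternate (\<open>not_always_near_infinity\<close>). But no affine point has an alternating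
      word (\<open>no_alternating\<close>): along such an itinerary the second iterate turns the orbit towards
      the region where the abscissa decreases by a definite amount, and the orbit cannot stay there.

  For the uniqueness, \<open>f\<close> takes the pencil of lines through \<open>(1, 0)\<close> to the pencil through
  \<open>(0, -1)\<close>, and vertical lines to horizontal lines. The double cones which these pencils cut out
  at a point are therefore invariant, even for the difference of two points at finite distance:
  comparing two points of \<open>Rect 0\<close> through their ordinates and their slopes seen from \<open>(0, -1)\<close> gives a
  forward invariant relation, the unstable one. In this relation the ratio of the two slopes never
  decreases (\<open>single_one_step\<close>), and it grows by a definite factor whenever the word has two zeros in
  a row (\<open>double_zero_step\<close>), although at such moments it is at most \<open>-a\<close>. Since two zeros in a row
  occur again and again, no such pair exists (\<open>no_unstable_pair\<close>). At a double zero two distinct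
  points with the same word are either in the unstable relation one step later, or in the relation
  obtained from it by time reversal (\<open>double_zero_at_0_unique\<close>). Time reversal is the
  reflection \<open>flip\<close>, which conjugates \<open>f\<close> to its inverse and preserves both rectangles.

  It remains to see that a limit of points with a prescribed finite itinerary has this itinerary
  (\<open>Rect_word_biitin\<close>). An affine point whose forward orbit leaves the plane arrives at
  \<open>(\<infinity>, a)\<close> and then moves along the lines at infinity with its finite coordinate at most \<open>a\<close>, so it never meets the
  indeterminacy point \<open>(-a, \<infinity>)\<close>, and \<open>f\<close> is continuous along the orbit.
\<close>

section \<open>Itineraries\<close>

definition determinate :: "real \<Rightarrow> torus \<Rightarrow> bool" where
  "determinate a p \<longleftrightarrow> p \<noteq> (Some 1, Some 0) \<and> p \<noteq> (Some (- a), None)"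

definition itin :: "real \<Rightarrow> (nat \<Rightarrow> nat) \<Rightarrow> torus \<Rightarrow> bool" where
  "itin a w p \<longleftrightarrow> (\<forall>k. (bir a ^^ k) p \<in> Rect (w k) \<and> determinate a ((bir a ^^ k) p))"

definition golden :: "(nat \<Rightarrow> nat) \<Rightarrow> bool" where
  "golden w \<longleftrightarrow> (\<forall>k. w k \<in> {0, 1} \<and> \<not> (w k = 1 \<and> w (Suc k) = 1))"

lemma itin_head: "itin a w p \<Longrightarrow> p \<in> Rect (w 0)"
  unfolding itin_def by (metis funpow_0)

lemma itin_shift: "itin a w p \<Longrightarrow> itin a (\<lambda>k. w (Suc k)) (bir a p)"
  unfolding itin_def by (metis comp_apply funpow_Suc_right)

lemma itin_head_Suc: "itin a w p \<Longrightarrow> bir a p \<in> Rect (w (Suc 0))"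
  using itin_head[OF itin_shift] by simp

lemma golden_shift: "golden w \<Longrightarrow> golden (\<lambda>k. w (Suc k))"
  unfolding golden_def by blast

lemma Rect0_iff:
  "(Some x, Some y) \<in> Rect 0 \<longleftrightarrow> 1 \<le> x \<and> y \<le> -1"
  "(Some x, None) \<in> Rect 0 \<longleftrightarrow> 1 \<le> x"
  "(None, Some y) \<in> Rect 0 \<longleftrightarrow> y \<le> -1"
  "(None, None) \<in> Rect 0"
  by (auto simp: Rect_def)

lemma Rect1_iff:
  "(Some x, Some y) \<in> Rect (Suc 0) \<longleftrightarrow> x \<le> 0 \<and> 0 \<le> y"
  "(Some x, None) \<in> Rect (Suc 0) \<longleftrightarrow> x \<le> 0"
  "(None, Some y) \<in> Rect (Suc 0) \<longleftrightarrow> 0 \<le> y"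
  "(None, None) \<in> Rect (Suc 0)"
  by (auto simp: Rect_def)

lemmas Rect_iff = Rect0_iff Rect1_iff

text \<open>
  Entering \<open>Rect 1\<close> requires \<open>x + a - 1 \<ge> 0\<close>. Hence the point is not on the line \<open>x = 1\<close>, which is
  sent to infinity, and its image is affine.
\<close>

lemma step_01:
  assumes "a < -1" "itin a w (Some x, Some y)" "w 0 = 0" "w (Suc 0) = 1"
  shows "bir a (Some x, Some y) = (Some (y * (x + a) / (x - 1)), Some (x + a - 1))"
    and "1 - a \<le> x" "y \<le> -1" "y * (x + a) / (x - 1) \<le> 0"
proof -
  have R: "1 \<le> x" "y \<le> -1" using itin_head[OF assms(2)] assms(3) by (auto simp: Rect_iff)
  have N: "bir a (Some x, Some y) \<in> Rect (Suc 0)" using itin_head_Suc[OF assms(2)] assms(4) by simp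
  have "x \<noteq> 1" using N R assms(1) by (auto simp: Rect_iff)
  then show E: "bir a (Some x, Some y) = (Some (y * (x + a) / (x - 1)), Some (x + a - 1))" by simp
  show "1 - a \<le> x" "y \<le> -1" "y * (x + a) / (x - 1) \<le> 0" using N R unfolding E by (auto simp: Rect_iff)
qed

lemma step_10:
  assumes "itin a w (Some x, Some y)" "w 0 = 1"
  shows "bir a (Some x, Some y) = (Some (y * (x + a) / (x - 1)), Some (x + a - 1))"
    and "x \<le> 0" "0 \<le> y"
  using itin_head[OF assms(1)] assms(2) by (auto simp: Rect_iff)

text \<open>
  Here \<open>-X\<close> is the abscissa of the intermediate point in \<open>Rect 1\<close>.
\<close>

lemma step_010:
  assumes "a < -1" "itin a w (Some x, Some y)" "w 0 = 0" "w (Suc 0) = 1" "w (Suc (Suc 0)) = 0"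
  defines "X \<equiv> - (y * (x + a) / (x - 1))"
  shows "bir a (bir a (Some x, Some y)) = (Some ((x + a - 1) * (X - a) / (X + 1)), Some (- (X - a) - 1))"
    and "1 - a < x" "y \<le> -1" "0 \<le> X" "1 \<le> (x + a - 1) * (X - a) / (X + 1)"
proof -
  note s = step_01[OF assms(1-4)]
  let ?z = "y * (x + a) / (x - 1)"
  have i2: "itin a (\<lambda>k. w (Suc k)) (Some ?z, Some (x + a - 1))"
    using itin_shift[OF assms(2)] s(1) by simp
  note t = step_10[OF i2 assms(4)]
  have X: "0 \<le> X" using s(4) X_def by simp
  have e: "(x + a - 1) * (?z + a) / (?z - 1) = (x + a - 1) * (X - a) / (X + 1)"
  proof -
    have z: "?z = - X" by (simp add: X_def)
    have "(-X + a) / (-X - 1) = (X - a) / (X + 1)" using X by (simp add: field_simps)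
    then show ?thesis unfolding z by (metis times_divide_eq_right)
  qed
  show b: "bir a (bir a (Some x, Some y)) = (Some ((x + a - 1) * (X - a) / (X + 1)), Some (- (X - a) - 1))"
    unfolding s(1) t(1) e by (simp add: X_def)
  have "bir a (bir a (Some x, Some y)) \<in> Rect 0"
    using itin_head_Suc[OF i2] assms(5) s(1) by simp
  then show l: "1 \<le> (x + a - 1) * (X - a) / (X + 1)" unfolding b by (auto simp: Rect_iff)
  show "1 - a < x"
  proof (rule ccontr)
    assume "\<not> 1 - a < x"
    then have "x + a - 1 = 0" using s(2) by simp
    then show False using l by simp
  qed
  show "y \<le> -1" "0 \<le> X" using s X by auto
qed

section \<open>No affine point has an alternating word\<close>

text \<open>
  This is the second iterate near \<open>(\<infinity>, \<infinity>)\<close>, with \<open>x\<close> the abscissa and \<open>u\<close> the quotient of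
  \<open>\<bar>y\<bar> - 1\<close> by \<open>x\<close>. The quotient increases. Once \<open>u \<ge> 1\<close>, the abscissa decreases by at least \<open>2\<close> in
  each step, which is impossible. If \<open>u < 1\<close> for ever, then \<open>ln x\<close> grows at most like a multiple of \<open>u\<close>,
  so \<open>x\<close> is bounded and the increments \<open>2 / x\<close> carry \<open>u\<close> beyond \<open>1\<close> after all.
\<close>

lemma no_escaping_sequence:
  fixes x u :: "nat \<Rightarrow> real"
  assumes b: "b > 1" and x1: "\<And>n. 1 \<le> x n" and u0: "\<And>n. 0 \<le> u n"
    and xs: "\<And>n. x (Suc n) = x n - b - 1 + (b - 1) / u (Suc n)"
    and us: "\<And>n. u n + 2 / x n \<le> u (Suc n)"
  shows False
proof -
  have xp: "0 < x n" for n using x1[of n] by linarith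
  have inc: "u n \<le> u (Suc n)" for n using us[of n] xp[of n] by (smt (verit) divide_pos_pos)
  have mono: "m \<le> n \<Longrightarrow> u m \<le> u n" for m n using inc by (rule lift_Suc_mono_le)
  show False
  proof (cases "\<exists>N. 1 \<le> u N")
    case True
    then obtain N where N: "1 \<le> u N" by blast
    have d: "x (N + k) \<le> x N - 2 * real k" for k
    proof (induction k)
      case (Suc k)
      have "1 \<le> u (Suc (N + k))" using mono[of N "Suc (N + k)"] N by simp
      then have "(b - 1) / u (Suc (N + k)) \<le> b - 1" using b by (simp add: divide_le_eq mult_le_cancel_left1)
      then show ?case using xs[of "N + k"] Suc by simp
    qed simp
    obtain k :: nat where "real k > x N" using reals_Archimedean2 by blast
    then show False using d[of k] x1[of "N + k"] by linarith
  next
    case False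
    define C where "C = (b - 1) * x 0 / 2"
    have C: "C > 0" using b xp[of 0] by (simp add: C_def)
    have st: "x (Suc n) \<le> x n + C" for n
    proof -
      have "2 / x 0 \<le> u (Suc n)" using us[of 0] u0[of 0] mono[of "Suc 0" "Suc n"] by simp
      then have "(b - 1) / u (Suc n) \<le> (b - 1) / (2 / x 0)"
        using b xp[of 0] divide_pos_pos[of 2 "x 0"] by (intro divide_left_mono mult_pos_pos; linarith)
      then show ?thesis using xs[of n] b by (simp add: C_def)
    qed
    have lg: "ln (x n) \<le> ln (x 0) + C / 2 * (u n - u 0)" for n
    proof (induction n)
      case (Suc n)
      have "ln (x (Suc n)) - ln (x n) = ln (x (Suc n) / x n)" using xp[of n] xp[of "Suc n"] by (simp add: ln_div)
      also have "\<dots> \<le> x (Suc n) / x n - 1" using xp by (intro ln_le_minus_one divide_pos_pos)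
      also have "\<dots> \<le> C / x n" using divide_right_mono[OF st[of n], of "x n"] xp[of n] by (simp add: add_divide_distrib)
      also have "\<dots> = C / 2 * (2 / x n)" by simp
      also have "\<dots> \<le> C / 2 * (u (Suc n) - u n)" using us[of n] C by (intro mult_left_mono) auto
      finally show ?case using Suc unfolding right_diff_distrib by linarith
    qed simp
    define K where "K = exp (ln (x 0) + C / 2)"
    have xK: "x n \<le> K" for n
    proof -
      have "u n < 1" using False by (meson not_le)
      then have "C / 2 * (u n - u 0) \<le> C / 2 * 1" using C u0[of 0] by (intro mult_left_mono) auto
      then have "ln (x n) \<le> ln (x 0) + C / 2" using lg[of n] by simp
      then show ?thesis unfolding K_def using xp[of n] by (metis exp_le_cancel_iff exp_ln)
    qed
    have K: "K > 0" by (simp add: K_def)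
    have g: "real n * (2 / K) \<le> u n" for n
    proof (induction n)
      case (Suc n)
      have "2 / K \<le> 2 / x n" using xK[of n] xp[of n] K by (intro divide_left_mono) auto
      moreover have "real (Suc n) * (2 / K) = real n * (2 / K) + 2 / K"
        by (simp only: of_nat_Suc distrib_right mult_1 add.commute)
      ultimately show ?case using us[of n] Suc by linarith
    qed (use u0 in simp)
    obtain n :: nat where "real n > K" using reals_Archimedean2 by blast
    then have "real n * (2 / K) > 1" using K by (simp add: field_simps)
    then show False using g[of n] False by (meson less_le_trans not_le less_imp_le)
  qed
qed

text \<open>
  Along the even times, the quotient \<open>u\<close> of \<open>-y - 1\<close> by \<open>x\<close> becomes \<open>(Z + 1) / (x + a - 1)\<close>, where \<open>-Z\<close> is
  the abscissa in between. This is at least \<open>-y / x + 1 / x = u + 2 / x\<close>, as \<open>no_escaping_sequence\<close> requires.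
\<close>

lemma no_alternating:
  assumes a: "a < -1" and it: "itin a w (Some x, Some y)" and w: "\<And>k. w k = k mod 2"
  shows False
proof -
  let ?P = "\<lambda>n. (bir a ^^ (2 * n)) (Some x, Some y)"
  have it': "itin a w (?P n)" for n
  proof (induction n)
    case (Suc n)
    have "itin a (\<lambda>k. w (Suc (Suc k))) (bir a (bir a (?P n)))"
      using itin_shift[OF itin_shift[OF Suc]] by simp
    moreover have "(\<lambda>k. w (Suc (Suc k))) = w" using w by auto
    ultimately show ?case by simp
  qed (use it in simp)
  have w012: "w 0 = 0" "w (Suc 0) = 1" "w (Suc (Suc 0)) = 0" by (simp_all add: w)
  note S = step_010[OF a _ w012]
  have ex: "\<exists>x y. ?P n = (Some x, Some y)" for n
  proof (induction n)
    case 0 then show ?case by simp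
  next
    case (Suc n)
    then obtain x y where "?P n = (Some x, Some y)" by blast
    then show ?case using S(1)[of x y] it'[of n] by simp
  qed
  then obtain X Y where P: "\<And>n. ?P n = (Some (X n), Some (Y n))" by metis
  have itP: "itin a w (Some (X n), Some (Y n))" for n using it'[of n] P by simp
  define Z where "Z n = - (Y n * (X n + a) / (X n - 1))" for n
  have Z0: "0 \<le> Z n" and Y1: "Y n \<le> -1" and Xb: "1 - a < X n" for n
    using S(2-4)[OF itP[of n]] unfolding Z_def by auto
  have XS: "X (Suc n) = (X n + a - 1) * (Z n - a) / (Z n + 1)" and YS: "Y (Suc n) = - (Z n - a) - 1" for n
    using S(1)[OF itP[of n]] P[of n] P[of "Suc n"] unfolding Z_def by auto
  define u where "u n = (- Y n - 1) / X n" for n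
  have uS: "u (Suc n) = (Z n + 1) / (X n + a - 1)" for n
  proof -
    have "Z n - a > 0" "Z n + 1 > 0" "X n + a - 1 > 0" using Z0[of n] Xb[of n] a by auto
    moreover have "N / (g * N / M) = M / g" if "N > 0" "M > 0" "g > 0" for N M g :: real
      using that by simp
    ultimately show ?thesis unfolding u_def XS YS by simp
  qed
  show False
  proof (rule no_escaping_sequence[of "-a" X u])
    show "-a > 1" using a by simp
    show x1: "1 \<le> X n" for n using Xb[of n] a by linarith
    show "0 \<le> u n" for n unfolding u_def using Y1[of n] Xb[of n] a by (intro divide_nonneg_nonneg) auto
    show "X (Suc n) = X n - - a - 1 + (- a - 1) / u (Suc n)" for n
    proof -
      have "Z n + 1 > 0" "X n + a - 1 > 0" using Z0[of n] Xb[of n] by auto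
      then show ?thesis unfolding uS XS by (simp add: field_simps)
    qed
    show "u n + 2 / X n \<le> u (Suc n)" for n
    proof -
      let ?x = "X n" and ?Y = "- Y n" let ?g = "?x + a - 1"
      have g: "?g > 0" "?x > 1" using Xb[of n] a by auto
      have "1 / ?x \<le> (?x + a) / ((?x - 1) * ?g)"
      proof -
        have "(?x - 1) * ?g = ?x * (?x + a) - ?x - ?g" by (simp add: algebra_simps)
        then have "(?x - 1) * ?g \<le> ?x * (?x + a)" using g by linarith
        moreover have "0 < (?x - 1) * ?g" using g by simp
        moreover have "1 / p \<le> q / r" if "r \<le> p * q" "0 < r" "0 < p" for p q r :: real
          using that by (simp add: pos_le_divide_eq pos_divide_le_eq mult.commute)
        ultimately show ?thesis using g by simp
      qed
      then have "?Y * (1 / ?x) \<le> ?Y * ((?x + a) / ((?x - 1) * ?g))"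
        using Y1[of n] by (intro mult_left_mono) auto
      moreover have "?Y * ((?x + a) / ((?x - 1) * ?g)) = Z n / ?g" unfolding Z_def by simp
      moreover have "1 / ?x \<le> 1 / ?g" using g a by (intro divide_left_mono) auto
      moreover have "u n + 2 / ?x = ?Y * (1 / ?x) + 1 / ?x" unfolding u_def using g by (simp add: field_simps)
      ultimately show ?thesis unfolding uS by (simp add: add_divide_distrib)
    qed
  qed
qed

text \<open>
  A word without \<open>11\<close> and without \<open>00\<close> alternates; if it begins with \<open>1\<close>, one step of the orbit
  reduces it to the case of a word beginning with \<open>0\<close>.
\<close>

lemma ex_double_zero:
  assumes a: "a < -1" and it: "itin a w (Some x, Some y)" and w: "golden w"
  shows "\<exists>k. w k = 0 \<and> w (Suc k) = 0"
proof (rule ccontr)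
  assume "\<not> ?thesis"
  then have alt: "w (Suc k) = 1 - w k" for k using w unfolding golden_def
    by (metis cancel_comm_monoid_add_class.diff_cancel diff_zero empty_iff insert_iff)
  have par: "v k = k mod 2" if "v 0 = 0" "\<And>k. v (Suc k) = 1 - v k" for v :: "nat \<Rightarrow> nat" and k
    by (induction k) (auto simp: that mod_Suc)
  have "w 0 \<in> {0, 1}" using w by (simp add: golden_def)
  then consider "w 0 = 0" | "w 0 = 1" by auto
  then show False
  proof cases
    case 1 then show False using no_alternating[OF a it] par alt by blast
  next
    case 2
    show False using no_alternating[OF a itin_shift[OF it, unfolded step_10(1)[OF it 2]]] par[of "\<lambda>k. w (Suc k)"] alt 2 by simp
  qed
qed

section \<open>Itineraries that reach infinity\<close>

lemma affine_step_00:
  assumes "a < -1" "itin a w (Some x, Some y)" "w 0 = 0" "w (Suc 0) = 0" "x \<noteq> 1"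
  shows "bir a (Some x, Some y) = (Some (y * (x + a) / (x - 1)), Some (x + a - 1))"
    and "1 < x" "x < - a" "y \<le> -1" "1 \<le> y * (x + a) / (x - 1)"
proof -
  have R: "1 \<le> x" "y \<le> -1" using itin_head[OF assms(2)] assms(3) by (auto simp: Rect_iff)
  have N: "bir a (Some x, Some y) \<in> Rect 0" using itin_head_Suc[OF assms(2)] assms(4) by simp
  show E: "bir a (Some x, Some y) = (Some (y * (x + a) / (x - 1)), Some (x + a - 1))"
    using assms(5) by simp
  show "1 \<le> y * (x + a) / (x - 1)" using N unfolding E by (auto simp: Rect_iff)
  then have "x \<noteq> - a" by auto
  moreover have "x \<le> - a" using N unfolding E by (auto simp: Rect_iff)
  ultimately show "x < - a" by simp
  show "1 < x" "y \<le> -1" using R assms(5) by auto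
qed

text \<open>
  The orbit of \<open>(\<infinity>, c)\<close> is \<open>(c, \<infinity>)\<close>, \<open>(\<infinity>, c + a - 1)\<close>, and so on. For \<open>c \<le> a\<close> its points lie
  alternately in only one of the rectangles. This is the tail of the orbit of a point that reaches
  infinity, since the line \<open>x = 1\<close> is mapped to \<open>(\<infinity>, a)\<close>.
\<close>

lemma infinite_itin:
  assumes a: "a < -1"
  shows "itin a w (None, Some c) \<Longrightarrow> golden w \<Longrightarrow> c \<le> a \<Longrightarrow> w k = k mod 2"
proof (induction k arbitrary: w c rule: less_induct)
  case (less k)
  have "w 0 \<in> {0,1}" "w (Suc 0) \<in> {0,1}" using less.prems(2) by (auto simp: golden_def)
  moreover have "w 0 \<noteq> 1" using itin_head[OF less.prems(1)] less.prems(3) a by (auto simp: Rect_iff)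
  moreover have "w (Suc 0) \<noteq> 0"
  proof
    assume "w (Suc 0) = 0"
    then have "(Some c, None) \<in> Rect 0" using itin_head_Suc[OF less.prems(1)] by simp
    then show False using less.prems(3) a by (simp add: Rect_iff)
  qed
  ultimately have w01: "w 0 = 0" "w (Suc 0) = 1" by auto
  have "itin a (\<lambda>k. w (Suc k)) (Some c, None)" using itin_shift[OF less.prems(1)] by simp
  from itin_shift[OF this] have i2: "itin a (\<lambda>k. w (Suc (Suc k))) (None, Some (c + a - 1))"
    using less.prems(3) a by simp
  consider "k = 0" | "k = Suc 0" | j where "k = Suc (Suc j)" by (metis old.nat.exhaust)
  then show ?case
  proof cases
    case 3
    have "w (Suc (Suc j)) = j mod 2"
      using less.IH[OF _ i2 golden_shift[OF golden_shift[OF less.prems(2)]], of j] 3 less.prems(3) a by simp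
    then show ?thesis using 3 by simp
  qed (use w01 in auto)
qed

lemma affine_not_infinite_itin:
  assumes "a < -1" "golden w" "itin a w (Some x, Some y)" "itin a w (None, Some c)" "c \<le> a"
  shows False
  using no_alternating[OF assms(1,3)] infinite_itin[OF assms(1,4,2,5)] by blast

section \<open>The unstable relation and its expansion\<close>

lemma image_abscissa_mono:
  fixes a x1 x2 y1 y2 :: real
  assumes "a < -1" "- a \<le> x1" "x1 \<le> x2" "y2 \<le> y1" "y1 \<le> 0"
  shows "- (y1 * (x1 + a) / (x1 - 1)) \<le> - (y2 * (x2 + a) / (x2 - 1))"
proof -
  have "(x1 + a) / (x1 - 1) = 1 - (- a - 1) / (x1 - 1)" "(x2 + a) / (x2 - 1) = 1 - (- a - 1) / (x2 - 1)"
    using assms by (auto simp: field_simps)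
  moreover have "(- a - 1) / (x2 - 1) \<le> (- a - 1) / (x1 - 1)"
    using assms by (intro divide_left_mono mult_pos_pos) auto
  ultimately have "(x1 + a) / (x1 - 1) \<le> (x2 + a) / (x2 - 1)" by linarith
  moreover have "0 \<le> (x1 + a) / (x1 - 1)" using assms by (intro divide_nonneg_nonneg) auto
  ultimately have "(- y1) * ((x1 + a) / (x1 - 1)) \<le> (- y2) * ((x2 + a) / (x2 - 1))"
    using assms by (intro mult_mono) auto
  then show ?thesis by simp
qed

text \<open>
  For a point of \<open>Rect 0\<close>, the quotient \<open>x / (-y - 1)\<close> is the absolute value of the inverse slope of
  the line joining it to \<open>(0, -1)\<close>. The relation says that the second point lies weakly to the
  right of and below the first, and that its quotient is at least \<open>A\<close> times that of the first; the
  fractions are cleared, and \<open>y1 < -1\<close> keeps both quotients finite. For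
  \<open>A > 1\<close> this is a finite-difference version of an unstable cone, and \<open>A\<close> measures the size of the difference.
\<close>

inductive spread :: "real \<Rightarrow> torus \<Rightarrow> torus \<Rightarrow> bool" where
  "\<lbrakk>1 \<le> x1; x1 \<le> x2; y2 \<le> y1; y1 < -1; A * (x1 * (- y2 - 1)) \<le> x2 * (- y1 - 1)\<rbrakk>
    \<Longrightarrow> spread A (Some x1, Some y1) (Some x2, Some y2)"

text \<open>
  The slope of the line from \<open>(1, 0)\<close> to a point is the inverse slope of the line from \<open>(0, -1)\<close> to
  its image: \<open>x' / (y' + 1) = y / (x - 1)\<close>. So the last assumption, a comparison of slopes seen from
  \<open>(1, 0)\<close>, becomes the comparison required for the images. The images are exchanged because \<open>f\<close>
  reverses the left-right order between these points.
\<close>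

lemma spread_image_00:
  fixes a x1 x2 y1 y2 B :: real
  assumes x: "1 < x1" "x1 \<le> x2" "x2 < - a" and y: "y1 < 0" "y2 < 0"
    and R: "1 \<le> y2 * (x2 + a) / (x2 - 1)"
    and B: "1 \<le> B" "B * (- y2 * (x1 - 1)) \<le> - y1 * (x2 - 1)"
  shows "spread B (Some (y2 * (x2 + a) / (x2 - 1)), Some (x2 + a - 1))
                  (Some (y1 * (x1 + a) / (x1 - 1)), Some (x1 + a - 1))"
proof -
  define s1 where "s1 = - y1 / (x1 - 1)"
  define s2 where "s2 = - y2 / (x2 - 1)"
  define e1 where "e1 = - (x1 + a)"
  define e2 where "e2 = - (x2 + a)"
  have e: "0 < e2" "e2 \<le> e1" "0 < e1" using x by (auto simp: e1_def e2_def)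
  have s0: "0 < s2" unfolding s2_def using x y by (intro divide_pos_pos) auto
  have s: "B * s2 \<le> s1"
    using B(2) x by (simp add: s1_def s2_def field_simps)
  then have s12: "s2 \<le> s1" using B(1) s0 by (smt (verit) mult_right_mono mult_cancel_right1)
  have z1: "y1 * (x1 + a) / (x1 - 1) = s1 * e1" and z2: "y2 * (x2 + a) / (x2 - 1) = s2 * e2"
    by (auto simp: s1_def s2_def e1_def e2_def algebra_simps diff_divide_distrib add_divide_distrib)
  show ?thesis unfolding z1 z2
  proof (rule spread.intros)
    show "1 \<le> s2 * e2" using R z2 by simp
    show "s2 * e2 \<le> s1 * e1" using s12 e s0 by (intro mult_mono) auto
    show "x1 + a - 1 \<le> x2 + a - 1" "x2 + a - 1 < - 1" using x by auto
    have "(B * s2) * (e1 * e2) \<le> s1 * (e1 * e2)" using s e by (intro mult_right_mono) auto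
    then show "B * (s2 * e2 * (- (x1 + a - 1) - 1)) \<le> s1 * e1 * (- (x2 + a - 1) - 1)"
      by (simp add: e1_def e2_def algebra_simps)
  qed
qed

text \<open>
  The points after a block \<open>010\<close> in terms of the data of the intermediate point in \<open>Rect 1\<close>: \<open>g\<close> is
  its ordinate and \<open>-X\<close> its abscissa. The quotient that defines \<open>spread\<close> is \<open>g / (X + 1)\<close> at the end of
  the block.
\<close>

lemma spread_image_010:
  fixes a g1 g2 X1 X2 B :: real
  assumes a: "a < -1" and g: "0 < g1" "0 < g2" and X: "0 \<le> X1" "X1 \<le> X2"
    and R: "1 \<le> g1 * (X1 - a) / (X1 + 1)"
    and B: "1 \<le> B" "B * (g1 * (X2 + 1)) \<le> g2 * (X1 + 1)"
  shows "spread B (Some (g1 * (X1 - a) / (X1 + 1)), Some (- (X1 - a) - 1))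
                  (Some (g2 * (X2 - a) / (X2 + 1)), Some (- (X2 - a) - 1))"
proof -
  define r1 where "r1 = g1 / (X1 + 1)"
  define r2 where "r2 = g2 / (X2 + 1)"
  have r0: "0 < r1" using g X by (simp add: r1_def)
  have r: "B * r1 \<le> r2" using B(2) X by (simp add: r1_def r2_def field_simps)
  then have r12: "r1 \<le> r2" using B(1) r0 by (smt (verit) mult_right_mono mult_cancel_right1)
  have z: "g1 * (X1 - a) / (X1 + 1) = r1 * (X1 - a)" "g2 * (X2 - a) / (X2 + 1) = r2 * (X2 - a)"
    by (auto simp: r1_def r2_def)
  show ?thesis unfolding z
  proof (rule spread.intros)
    show "1 \<le> r1 * (X1 - a)" using R z by simp
    show "r1 * (X1 - a) \<le> r2 * (X2 - a)" using r12 X r0 a by (intro mult_mono) auto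
    show "- (X2 - a) - 1 \<le> - (X1 - a) - 1" "- (X1 - a) - 1 < - 1" using X a by auto
    have "(B * r1) * ((X1 - a) * (X2 - a)) \<le> r2 * ((X1 - a) * (X2 - a))"
      using r X a by (intro mult_right_mono) auto
    then show "B * (r1 * (X1 - a) * (- (- (X2 - a) - 1) - 1)) \<le> r2 * (X2 - a) * (- (- (X1 - a) - 1) - 1)"
      by (simp add: mult_ac)
  qed
qed

text \<open>
  Write \<open>Y\<close> for \<open>-y\<close>. The new ratio of the quotients, divided by the old one
  \<open>x\<^sub>2 (Y\<^sub>1 - 1) / (x\<^sub>1 (Y\<^sub>2 - 1))\<close>, is
  \<open>(1 - 1 / Y\<^sub>2) / (1 - 1 / Y\<^sub>1)\<close> times \<open>(1 - 1 / x\<^sub>2) / (1 - 1 / x\<^sub>1)\<close>. Both factors are at least \<open>1\<close>, and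
  since \<open>x\<^sub>2 \<ge> A0 x\<^sub>1\<close> and \<open>x\<^sub>1 < b\<close>, the second one is bounded away from \<open>1\<close>.
\<close>

lemma expansion_00:
  fixes b x1 x2 Y1 Y2 A A0 :: real
  assumes x: "1 < x1" "x1 \<le> x2" "x2 < b" and Y: "1 < Y1" "Y1 \<le> Y2" and A: "1 < A0" "A0 \<le> A"
    and S: "A * (x1 * (Y2 - 1)) \<le> x2 * (Y1 - 1)"
  shows "(1 + (1 - 1 / A0) / (b - 1)) * A * (Y2 * (x1 - 1)) \<le> Y1 * (x2 - 1)" "A \<le> b"
proof -
  define \<delta> where "\<delta> = 1 + (1 - 1 / A0) / (b - 1)"
  have "x2 * (Y1 - 1) \<le> x2 * (Y2 - 1)" using x Y by (intro mult_left_mono) auto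
  then have "(A * x1) * (Y2 - 1) \<le> x2 * (Y2 - 1)" using S by (simp add: mult.assoc)
  then have Ax: "A * x1 \<le> x2" using Y by (simp add: mult_le_cancel_right)
  have "A \<le> A * x1" using x A by simp
  then show "A \<le> b" using Ax x by linarith
  have AxY: "A * x1 * Y2 \<le> x2 * Y1"
  proof -
    have "x2 * (Y1 - 1) * Y2 \<le> x2 * (Y1 * (Y2 - 1))"
      using x Y by (simp add: algebra_simps)
    moreover have "A * (x1 * (Y2 - 1)) * Y2 \<le> x2 * (Y1 - 1) * Y2" using S Y by (intro mult_right_mono) auto
    ultimately have "(A * x1 * Y2) * (Y2 - 1) \<le> (x2 * Y1) * (Y2 - 1)" by (simp add: mult_ac)
    then show ?thesis using Y by (simp add: mult_le_cancel_right)
  qed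
  have d: "0 < \<delta>" unfolding \<delta>_def using A x by (intro add_pos_nonneg divide_nonneg_nonneg) auto
  have xx: "\<delta> * (x2 * (x1 - 1)) \<le> x1 * (x2 - 1)"
  proof -
    have "A0 * x1 \<le> x2" using Ax A x by (smt (verit) mult_right_mono)
    then have "x1 \<le> x2 / A0" using A by (simp add: field_simps)
    then have 1: "x2 * (1 - 1 / A0) \<le> x2 - x1" by (simp add: algebra_simps)
    have "(x1 - 1) / (b - 1) \<le> 1" using x by simp
    then have "(x1 - 1) / (b - 1) * (x2 * (1 - 1 / A0)) \<le> 1 * (x2 * (1 - 1 / A0))"
      using x A by (intro mult_right_mono) auto
    moreover have "\<delta> * (x2 * (x1 - 1)) = x2 * (x1 - 1) + (x1 - 1) / (b - 1) * (x2 * (1 - 1 / A0))"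
    proof -
      have "(1 + e / (b - 1)) * (x2 * (x1 - 1)) = x2 * (x1 - 1) + (x1 - 1) / (b - 1) * (x2 * e)" for e
        by (simp add: distrib_right)
      then show ?thesis unfolding \<delta>_def .
    qed
    ultimately show ?thesis using 1 by (simp add: algebra_simps)
  qed
  have "x1 * (\<delta> * A * (Y2 * (x1 - 1))) = (\<delta> * (x1 - 1)) * (A * x1 * Y2)" by (simp add: mult_ac)
  also have "\<dots> \<le> (\<delta> * (x1 - 1)) * (x2 * Y1)" using AxY d x by (intro mult_left_mono) auto
  also have "\<dots> = Y1 * (\<delta> * (x2 * (x1 - 1)))" by (simp add: mult_ac)
  also have "\<dots> \<le> Y1 * (x1 * (x2 - 1))" using xx Y by (intro mult_left_mono) auto
  finally have "x1 * (\<delta> * A * (Y2 * (x1 - 1))) \<le> x1 * (Y1 * (x2 - 1))" by (simp add: mult_ac)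
  then show "(1 + (1 - 1 / A0) / (b - 1)) * A * (Y2 * (x1 - 1)) \<le> Y1 * (x2 - 1)"
    using x unfolding \<delta>_def by (simp add: mult_le_cancel_left)
qed

text \<open>
  The old quotient \<open>x / (Y - 1)\<close> divided by the new one is
  \<open>x / (x - 1) * ((Y + 1) / (Y - 1) + (Y + b) / ((Y - 1) (x - b - 1)))\<close>, which is decreasing in both
  variables. Since the second point has the larger \<open>x\<close> and \<open>Y\<close>, the ratio of the quotients does not
  decrease.
\<close>

lemma no_contraction_010:
  fixes b x1 x2 Y1 Y2 A :: real
  assumes b: "1 < b" and x: "b + 1 < x1" "x1 \<le> x2" and Y: "1 < Y1" "Y1 \<le> Y2" and A: "0 < A"
    and S: "A * (x1 * (Y2 - 1)) \<le> x2 * (Y1 - 1)"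
  shows "A * ((x1 - b - 1) * (Y2 * (x2 - b) / (x2 - 1) + 1)) \<le> (x2 - b - 1) * (Y1 * (x1 - b) / (x1 - 1) + 1)"
proof -
  define H where "H x Y = x / (x - 1) * ((Y + 1) / (Y - 1) + (Y + b) / ((Y - 1) * (x - b - 1)))" for x Y
  have H: "(Y * (x - b) / (x - 1) + 1) = (x - b - 1) * (H x Y * ((Y - 1) / x))"
    if "b + 1 < x" "1 < Y" for x Y
  proof -
    have "(x - b - 1) * (H x Y * ((Y - 1) / x)) = ((x - b - 1) * (Y + 1) + (Y + b)) / (x - 1)"
    proof -
      define g where "g = x - b - 1"
      define z where "z = x - 1"
      define v where "v = Y - 1"
      have nz: "g \<noteq> 0" "z \<noteq> 0" "v \<noteq> 0" "x \<noteq> 0" using that b by (auto simp: g_def z_def v_def)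
      have "g * (x / z * ((Y + 1) / v + (Y + b) / (v * g)) * (v / x)) = (g * (Y + 1) + (Y + b)) / z"
        using nz by (simp add: field_simps)
      then show ?thesis unfolding H_def g_def z_def v_def .
    qed
    also have "(x - b - 1) * (Y + 1) + (Y + b) = Y * (x - b) + (x - 1)" by (simp add: algebra_simps)
    finally show ?thesis using that b by (simp add: add_divide_distrib)
  qed
  have frac: "(t + c) / (t - 1) \<le> (s + c) / (s - 1)" if "1 < s" "s \<le> t" "-1 \<le> c" for s t c :: real
  proof -
    have "(c + 1) * s \<le> (c + 1) * t" using that by (intro mult_left_mono) auto
    then have "(t + c) * (s - 1) \<le> (s + c) * (t - 1)" by (simp add: algebra_simps)
    then show ?thesis using that by (simp add: divide_le_eq le_divide_eq)
  qed
  have H21: "H x2 Y2 \<le> H x1 Y1"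
  proof -
    have "x2 / (x2 - 1) \<le> x1 / (x1 - 1)" using frac[of x1 x2 0] b x by simp
    moreover have "(Y2 + 1) / (Y2 - 1) \<le> (Y1 + 1) / (Y1 - 1)" using frac[of Y1 Y2 1] Y by simp
    moreover have "(Y2 + b) / ((Y2 - 1) * (x2 - b - 1)) \<le> (Y1 + b) / ((Y1 - 1) * (x1 - b - 1))"
    proof -
      have "(Y2 + b) / (Y2 - 1) / (x2 - b - 1) \<le> (Y1 + b) / (Y1 - 1) / (x1 - b - 1)"
      proof (rule frac_le)
        show "(Y2 + b) / (Y2 - 1) \<le> (Y1 + b) / (Y1 - 1)" using frac[of Y1 Y2 b] b Y by simp
        show "0 \<le> (Y1 + b) / (Y1 - 1)" using b Y by (intro divide_nonneg_nonneg) auto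
      qed (use x in auto)
      then show ?thesis by simp
    qed
    ultimately show ?thesis unfolding H_def using b x Y by (intro mult_mono add_mono) auto
  qed
  have H0: "0 \<le> H x1 Y1" unfolding H_def using b x Y by (intro mult_nonneg_nonneg add_nonneg_nonneg) auto
  have "A * ((Y2 - 1) / x2) \<le> (Y1 - 1) / x1" using S b x by (simp add: field_simps)
  then have "H x2 Y2 * (A * ((Y2 - 1) / x2)) \<le> H x1 Y1 * ((Y1 - 1) / x1)"
    using H21 H0 A Y x b by (intro mult_mono) auto
  then have "((x1 - b - 1) * (x2 - b - 1)) * (H x2 Y2 * (A * ((Y2 - 1) / x2)))
      \<le> ((x1 - b - 1) * (x2 - b - 1)) * (H x1 Y1 * ((Y1 - 1) / x1))"
    using x by (intro mult_left_mono) auto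
  then show ?thesis using H[of x1 Y1] H[of x2 Y2] x Y by (simp add: mult_ac)
qed

text \<open>
  Neither point can lie on the line \<open>x = 1\<close>. If both did, the relation would fail for \<open>A > 1\<close>; if
  only the left one did, its word would end in an alternating tail, which the affine image of the
  other point cannot share.
\<close>

lemma double_zero_step:
  assumes a: "a < -1" and sp: "spread A p q" and A: "1 < A0" "A0 \<le> A" and w: "golden w"
    and it: "itin a w p" "itin a w q" and w0: "w 0 = 0" and w1: "w (Suc 0) = 0"
  shows "spread ((1 + (1 - 1 / A0) / (- a - 1)) * A) (bir a q) (bir a p)" "A \<le> - a"
proof -
  from sp obtain x1 y1 x2 y2 where pq: "p = (Some x1, Some y1)" "q = (Some x2, Some y2)"
    and s: "1 \<le> x1" "x1 \<le> x2" "y2 \<le> y1" "y1 < -1" "A * (x1 * (- y2 - 1)) \<le> x2 * (- y1 - 1)"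
    by (cases rule: spread.cases) auto
  note it1 = it(1)[unfolded pq] and it2 = it(2)[unfolded pq]
  \<comment> \<open>the right point has the larger abscissa, so here both points would be on the line\<close>
  have x21: "x2 \<noteq> 1"
  proof
    assume "x2 = 1"
    then have "A * (- y2 - 1) \<le> - y1 - 1" using s by simp
    also have "\<dots> \<le> 1 * (- y2 - 1)" using s by simp
    finally show False using A s by (simp add: mult_le_cancel_right)
  qed
  note u2 = affine_step_00[OF a it2 w0 w1 x21]
  have "x1 \<noteq> 1"
  proof
    assume "x1 = 1"
    then have "bir a (Some x1, Some y1) = (None, Some a)" using s by simp
    then have "itin a (\<lambda>k. w (Suc k)) (None, Some a)" using itin_shift[OF it1] by simp
    then show False
      using affine_not_infinite_itin[OF a golden_shift[OF w] itin_shift[OF it2, unfolded u2(1)] _ order_refl] by blast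
  qed
  note u1 = affine_step_00[OF a it1 w0 w1 this]
  have 1: "(1 + (1 - 1 / A0) / (- a - 1)) * A * (- y2 * (x1 - 1)) \<le> - y1 * (x2 - 1)" "A \<le> - a"
    using expansion_00[of x1 x2 "-a" "-y1" "-y2" A0 A] u1 u2 s A by auto
  show "A \<le> - a" by (rule 1)
  have "1 \<le> (1 + (1 - 1 / A0) / (- a - 1))" using A a by (simp add: divide_nonneg_nonneg)
  then have "1 * 1 \<le> (1 + (1 - 1 / A0) / (- a - 1)) * A" using A by (intro mult_mono) auto
  then show "spread ((1 + (1 - 1 / A0) / (- a - 1)) * A) (bir a q) (bir a p)"
    unfolding pq u1(1) u2(1)
    using 1 u1 u2 s by (intro spread_image_00) auto
qed

lemma single_one_step:
  assumes a: "a < -1" and sp: "spread A p q" and A: "1 \<le> A"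
    and it: "itin a w p" "itin a w q" and w: "w 0 = 0" "w (Suc 0) = 1" "w (Suc (Suc 0)) = 0"
  shows "spread A (bir a (bir a p)) (bir a (bir a q))"
proof -
  from sp obtain x1 y1 x2 y2 where pq: "p = (Some x1, Some y1)" "q = (Some x2, Some y2)"
    and s: "1 \<le> x1" "x1 \<le> x2" "y2 \<le> y1" "y1 < -1" "A * (x1 * (- y2 - 1)) \<le> x2 * (- y1 - 1)"
    by (cases rule: spread.cases) auto
  note u1 = step_010[OF a it(1)[unfolded pq] w] and u2 = step_010[OF a it(2)[unfolded pq] w]
  have mono: "- (y1 * (x1 + a) / (x1 - 1)) \<le> - (y2 * (x2 + a) / (x2 - 1))"
    using image_abscissa_mono[OF a] u1(2) s by simp
  show ?thesis unfolding pq u1(1) u2(1)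
  proof (rule spread_image_010[OF a _ _ u1(4) mono u1(5) A])
    show "0 < x1 + a - 1" "0 < x2 + a - 1" using u1(2) u2(2) by auto
    show "A * ((x1 + a - 1) * (- (y2 * (x2 + a) / (x2 - 1)) + 1))
        \<le> (x2 + a - 1) * (- (y1 * (x1 + a) / (x1 - 1)) + 1)"
      using no_contraction_010[of "-a" x1 x2 "-y1" "-y2" A] a u1(2) s A by simp
  qed
qed

text \<open>
  Up to the next double zero the word runs through blocks \<open>010\<close>, which preserve the relation.
\<close>

lemma spread_at_double_zero:
  assumes a: "a < -1" and A: "1 \<le> A"
  shows "spread A p q \<Longrightarrow> golden w \<Longrightarrow> itin a w p \<Longrightarrow> itin a w q \<Longrightarrow> w 0 = 0 \<Longrightarrow> w m = 0 \<Longrightarrow> w (Suc m) = 0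
    \<Longrightarrow> \<exists>p' q' w'. spread A p' q' \<and> golden w' \<and> itin a w' p' \<and> itin a w' q' \<and> w' 0 = 0 \<and> w' (Suc 0) = 0"
proof (induction m arbitrary: p q w rule: less_induct)
  case (less m)
  show ?case
  proof (cases "w (Suc 0) = 0")
    case True
    then show ?thesis using less.prems by blast
  next
    case False
    then have w1: "w (Suc 0) = 1" and w2: "w (Suc (Suc 0)) = 0"
      using less.prems(2) unfolding golden_def by (metis empty_iff insert_iff)+
    have "m \<noteq> 0" "m \<noteq> Suc 0" using w1 less.prems by (auto intro: ccontr)
    then obtain j where m: "m = Suc (Suc j)" by (metis old.nat.exhaust)
    show ?thesis
      using less.IH[of j, OF _ single_one_step[OF a less.prems(1) A less.prems(3,4,5) w1 w2]
          golden_shift[OF golden_shift[OF less.prems(2)]] itin_shift[OF itin_shift[OF less.prems(3)]]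
          itin_shift[OF itin_shift[OF less.prems(4)]] w2] less.prems(6,7) m by simp
  qed
qed

text \<open>
  Each double zero multiplies \<open>A\<close> by \<open>\<delta>\<close>, yet \<open>A \<le> -a\<close> holds at every double zero.
\<close>

lemma no_spread_pair:
  assumes a: "a < -1" and A0: "1 < A0" and sp: "spread A0 p q" and w: "golden w"
    and it: "itin a w p" "itin a w q" and w0: "w 0 = 0"
  shows False
proof -
  define \<delta> where "\<delta> = 1 + (1 - 1 / A0) / (- a - 1)"
  have d: "1 < \<delta>" using A0 a by (simp add: \<delta>_def)
  have dz: "\<exists>p' q' w'. spread A p' q' \<and> golden w' \<and> itin a w' p' \<and> itin a w' q' \<and> w' 0 = 0 \<and> w' (Suc 0) = 0"
    if A: "A0 \<le> A" and st: "spread A p q" "golden w" "itin a w p" "itin a w q" "w 0 = 0" for A p q w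
  proof -
    from st(1) obtain x y where "p = (Some x, Some y)" by (cases rule: spread.cases) auto
    then obtain m where "w m = 0" "w (Suc m) = 0" using ex_double_zero[OF a _ st(2)] st(3) by metis
    then show ?thesis using spread_at_double_zero[OF a _ st] A A0 by simp
  qed
  have pow: "A0 \<le> A0 * \<delta> ^ j" for j using A0 d by (simp add: one_le_power)
  have "\<exists>p q w. spread (A0 * \<delta> ^ j) p q \<and> golden w \<and> itin a w p \<and> itin a w q \<and> w 0 = 0" for j
  proof (induction j)
    case 0
    then show ?case using sp w it w0 by (simp only: power_0 mult_1_right) blast
  next
    case (Suc j)
    then obtain p q w where "spread (A0 * \<delta> ^ j) p q" "golden w" "itin a w p" "itin a w q" "w 0 = 0" "w (Suc 0) = 0"
      using dz[OF pow] by blast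
    then have "spread (\<delta> * (A0 * \<delta> ^ j)) (bir a q) (bir a p)" "golden (\<lambda>k. w (Suc k))"
       "itin a (\<lambda>k. w (Suc k)) (bir a q)" "itin a (\<lambda>k. w (Suc k)) (bir a p)" "w (Suc 0) = 0"
      using double_zero_step(1)[OF a _ A0 pow] golden_shift itin_shift unfolding \<delta>_def by blast+
    then show ?case by (simp only: power_Suc mult.left_commute) blast
  qed
  moreover obtain j where "- a < \<delta> ^ j" using real_arch_pow[OF d] by blast
  then have "- a < A0 * \<delta> ^ j" using A0 d a
    by (smt (verit) mult_right_mono mult_cancel_right1)
  ultimately show False using dz[OF pow] double_zero_step(2)[OF a _ A0 pow] by (meson not_le)
qed

text \<open>
  The assumptions are the closed unstable relation, without a gap between the quotients and including
  the line \<open>y = -1\<close>, where the quotient is infinite. The slopes seen from \<open>(1, 0)\<close> are then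
  strictly ordered (fact \<open>S\<close>), so after one passage \<open>00\<close> or \<open>010\<close> the points are in the relation
  \<open>spread B\<close> for the ratio \<open>B > 1\<close> of their new quotients.
\<close>

lemma no_unstable_pair:
  assumes a: "a < -1" and it: "itin a w (Some x1, Some y1)" "itin a w (Some x2, Some y2)"
    and w: "golden w" and w0: "w 0 = 0" and ne: "x1 \<noteq> x2 \<or> y1 \<noteq> y2"
    and s: "x1 \<le> x2" "y2 \<le> y1" "x1 * (- y2 - 1) \<le> x2 * (- y1 - 1)"
  shows False
proof -
  have R: "1 \<le> x1" "1 \<le> x2" "y1 \<le> -1" "y2 \<le> -1"
    using it[THEN itin_head] w0 by (auto simp: Rect_iff)
  have S: "- y2 * (x1 - 1) < - y1 * (x2 - 1)"
  proof -
    have "0 < (x2 - x1) + (y1 - y2)" using ne s by auto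
    then show ?thesis using s(3) by (simp add: algebra_simps)
  qed
  have x2: "x2 \<noteq> 1"
  proof
    assume "x2 = 1"
    then have "x1 = 1" using s R by simp
    then show False using S \<open>x2 = 1\<close> by simp
  qed
  have "w (Suc 0) \<in> {0, 1}" using w by (simp add: golden_def)
  then consider "w (Suc 0) = 0" | "w (Suc 0) = 1" by auto
  then show False
  proof cases
    case 1
    note u2 = affine_step_00[OF a it(2) w0 1 x2]
    have "x1 \<noteq> 1"
    proof
      assume "x1 = 1"
      then have "bir a (Some x1, Some y1) = (None, Some a)" using R by simp
      then have "itin a (\<lambda>k. w (Suc k)) (None, Some a)" using itin_shift[OF it(1)] by simp
      then show False
        using affine_not_infinite_itin[OF a golden_shift[OF w] itin_shift[OF it(2), unfolded u2(1)] _ order_refl] by blast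
    qed
    note u1 = affine_step_00[OF a it(1) w0 1 this]
    define B where "B = - y1 * (x2 - 1) / (- y2 * (x1 - 1))"
    have D: "0 < - y2 * (x1 - 1)" using R u1(2) by (intro mult_pos_pos) auto
    have B: "1 < B" unfolding B_def using S D by (subst less_divide_eq_1_pos) auto
    have "B * (- y2 * (x1 - 1)) = - y1 * (x2 - 1)" using D unfolding B_def by auto
    then have "spread B (Some (y2 * (x2 + a) / (x2 - 1)), Some (x2 + a - 1))
                  (Some (y1 * (x1 + a) / (x1 - 1)), Some (x1 + a - 1))"
      using u1 u2 s B by (intro spread_image_00) auto
    then show False
      using no_spread_pair[OF a B _ golden_shift[OF w]] itin_shift[OF it(1)] itin_shift[OF it(2)] u1(1) u2(1) 1 by simp
  next
    case 2
    then have w2: "w (Suc (Suc 0)) = 0" using w unfolding golden_def by (metis empty_iff insert_iff)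
    note u1 = step_010[OF a it(1) w0 2 w2] and u2 = step_010[OF a it(2) w0 2 w2]
    define g1 where "g1 = x1 + a - 1" define g2 where "g2 = x2 + a - 1"
    define s1 where "s1 = - y1 / (x1 - 1)" define s2 where "s2 = - y2 / (x2 - 1)"
    have g: "0 < g1" "g1 \<le> g2" using u1(2) s by (auto simp: g1_def g2_def)
    have z: "- (y1 * (x1 + a) / (x1 - 1)) = s1 * (g1 + 1)" "- (y2 * (x2 + a) / (x2 - 1)) = s2 * (g2 + 1)"
      by (auto simp: s1_def s2_def g1_def g2_def)
    have s0: "0 < s2" unfolding s2_def using R u2(2) a by (intro divide_pos_pos) auto
    have s21: "s2 < s1"
    proof -
      have "p / r < q / t" if "p * t < q * r" "0 < r" "0 < t" for p q r t :: real
        using that by (simp add: field_simps)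
      then show ?thesis unfolding s1_def s2_def using S u1(2) u2(2) a by simp
    qed
    have X: "s1 * (g1 + 1) \<le> s2 * (g2 + 1)"
      using image_abscissa_mono[OF a, of x1 x2 y2 y1] u1(2) s R z by simp
    define B where "B = g2 * (s1 * (g1 + 1) + 1) / (g1 * (s2 * (g2 + 1) + 1))"
    have D: "0 < g1 * (s2 * (g2 + 1) + 1)" using g s0 by (intro mult_pos_pos add_pos_pos) auto
    have "g1 * (s2 * (g2 + 1) + 1) < g2 * (s1 * (g1 + 1) + 1)"
    proof -
      have "s2 * (g1 * g2) < s1 * (g1 * g2)" using s21 g by (intro mult_strict_right_mono) auto
      moreover have "g1 * s2 \<le> g2 * s1" using s21 s0 g by (intro mult_mono) auto
      moreover have "g1 * (s2 * (g2 + 1) + 1) = s2 * (g1 * g2) + g1 * s2 + g1"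
        "g2 * (s1 * (g1 + 1) + 1) = s1 * (g1 * g2) + g2 * s1 + g2" by (simp_all add: algebra_simps)
      ultimately show ?thesis using g by linarith
    qed
    then have B: "1 < B" unfolding B_def using D by (subst less_divide_eq_1_pos) auto
    have BE: "B * (g1 * (s2 * (g2 + 1) + 1)) = g2 * (s1 * (g1 + 1) + 1)" using D unfolding B_def by auto
    have "spread B (bir a (bir a (Some x1, Some y1))) (bir a (bir a (Some x2, Some y2)))"
      unfolding u1(1) u2(1) z g1_def[symmetric] g2_def[symmetric]
    proof (rule spread_image_010[OF a])
      show "0 \<le> s1 * (g1 + 1)" using s21 s0 g by auto
      show "1 \<le> g1 * (s1 * (g1 + 1) - a) / (s1 * (g1 + 1) + 1)" using u1(5) z g1_def by simp
    qed (use g X B BE in auto)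
    then show False
      using no_spread_pair[OF a B _ golden_shift[OF golden_shift[OF w]]]
        itin_shift[OF itin_shift[OF it(1)]] itin_shift[OF itin_shift[OF it(2)]] w2 by simp
  qed
qed

section \<open>Time reversal and uniqueness of the affine point of a word\<close>

text \<open>
  The reflection \<open>(x, y) \<mapsto> (-y, -x)\<close> conjugates the map to its inverse. Statements about backward
  orbits are therefore statements about forward orbits of the reflected point.
\<close>

definition flip :: "torus \<Rightarrow> torus" where
  "flip p = (map_option uminus (snd p), map_option uminus (fst p))"

lemma flip_simps [simp]:
  "flip (Some x, Some y) = (Some (- y), Some (- x))"
  "flip (None, Some y) = (Some (- y), None)"
  "flip (Some x, None) = (None, Some (- x))"
  "flip (None, None) = (None, None)"
  by (simp_all add: flip_def)

lemma torus_cases: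
  obtains x y where "p = (Some x, Some y)" | x where "p = (Some x, None)"
    | y where "p = (None, Some y)" | "p = (None, None)"
  by (metis option.exhaust surj_pair)

lemma flip_flip [simp]: "flip (flip p) = p"
  by (cases p rule: torus_cases) auto

lemma flip_Rect [simp]: "flip p \<in> Rect i \<longleftrightarrow> p \<in> Rect i"
  by (cases p rule: torus_cases; cases i) (auto simp: Rect_def image_iff)

lemma affine_pts_iff: "p \<in> affine_pts \<longleftrightarrow> (\<exists>x y. p = (Some x, Some y))"
  by (auto simp: affine_pts_def)

lemma flip_affine [simp]: "flip p \<in> affine_pts \<longleftrightarrow> p \<in> affine_pts"
  by (cases p rule: torus_cases) (auto simp: affine_pts_iff)

lemma affine_Rect_determinate: "p \<in> affine_pts \<Longrightarrow> p \<in> Rect i \<Longrightarrow> determinate a p"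
  by (auto simp: affine_pts_iff determinate_def Rect_def split: if_splits)

text \<open>
  Reversibility, in the form \<open>f \<circ> flip \<circ> f = flip\<close>. It needs a point that is neither on \<open>x = 1\<close>, which
  is sent to infinity, nor on \<open>x = -a\<close>, which is sent to the point \<open>(0, -1)\<close> outside both
  rectangles.
\<close>

lemma bir_flip_bir:
  assumes a: "a < -1" and p: "p \<in> affine_pts" "p \<in> Rect i" "bir a p \<in> affine_pts" "bir a p \<in> Rect j"
  shows "bir a (flip (bir a p)) = flip p"
proof -
  obtain x y where xy: "p = (Some x, Some y)" using p by (auto simp: affine_pts_iff)
  have det: "x \<noteq> 1 \<or> y \<noteq> 0" using affine_Rect_determinate[OF p(1,2)] by (auto simp: xy determinate_def)
  then have x1: "x \<noteq> 1" using p(3) xy by (auto simp: affine_pts_iff)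
  then have xa: "x \<noteq> - a" using p(4) xy by (auto simp: Rect_def split: if_splits)
  then have "x + a \<noteq> 0" by simp
  then have "y * (x + a) / (x - 1) * (- x + 1) / (- x - a) = y"
    using x1 by (simp add: divide_simps) (simp add: algebra_simps)
  then show ?thesis using x1 xa unfolding xy by (auto simp: algebra_simps)
qed

definition biitin :: "real \<Rightarrow> (int \<Rightarrow> nat) \<Rightarrow> torus \<Rightarrow> bool" where
  "biitin a w p \<longleftrightarrow> p \<in> affine_pts \<and> itin a (\<lambda>k. w (int k)) p \<and> itin a (\<lambda>k. w (- int k)) (flip p)"

lemma words_values: "w \<in> words \<Longrightarrow> w i = 0 \<or> w i = 1"
  unfolding words_def by (metis (lifting) empty_iff insert_iff mem_Collect_eq rangeI subsetD)

lemma words_no_11: "w \<in> words \<Longrightarrow> w i = 1 \<Longrightarrow> w (i + 1) = 0"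
  using words_values[of w "i + 1"] unfolding words_def by auto

lemma words_no_11': "w \<in> words \<Longrightarrow> w i = 1 \<Longrightarrow> w (i - 1) = 0"
  using words_values[of w "i - 1"] unfolding words_def by (metis (mono_tags, lifting) diff_add_cancel mem_Collect_eq)

lemma words_shift: "w \<in> words \<Longrightarrow> (\<lambda>k. w (k + 1)) \<in> words"
proof -
  assume w: "w \<in> words"
  have "w (k + 1) \<in> {0, 1}" for k using words_values[OF w, of "k + 1"] by auto
  then have "range (\<lambda>k. w (k + 1)) \<subseteq> {0, 1}" by (rule image_subsetI)
  moreover have "\<not> (\<exists>i. w (i + 1) = 1 \<and> w (i + 1 + 1) = 1)"
    using words_no_11[OF w] by (metis zero_neq_one)
  ultimately show ?thesis unfolding words_def by simp
qed

lemma golden_words: "w \<in> words \<Longrightarrow> golden (\<lambda>k. w (int k))" "w \<in> words \<Longrightarrow> golden (\<lambda>k. w (- int k))"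
proof -
  assume w: "w \<in> words"
  show "golden (\<lambda>k. w (int k))" unfolding golden_def
    using words_values[OF w] words_no_11[OF w] by (metis empty_iff insert_iff of_nat_Suc add.commute zero_neq_one)
  have "- int (Suc k) = - int k - 1" for k by simp
  then show "golden (\<lambda>k. w (- int k))" unfolding golden_def
    using words_values[OF w] words_no_11'[OF w] by (metis empty_iff insert_iff zero_neq_one)
qed

lemma biitin_shift:
  assumes a: "a < -1" and p: "biitin a w p" and aff: "bir a p \<in> affine_pts"
  shows "biitin a (\<lambda>k. w (k + 1)) (bir a p)"
proof -
  have i1: "itin a (\<lambda>k. w (int k + 1)) (bir a p)"
    using itin_shift[of a "\<lambda>k. w (int k)" p] p by (simp add: biitin_def add.commute)
  have R: "bir a p \<in> Rect (w 1)" using itin_head[OF i1] by simp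
  have pR: "p \<in> affine_pts" "p \<in> Rect (w 0)" using p itin_head[of a "\<lambda>k. w (int k)" p] by (auto simp: biitin_def)
  have ff: "bir a (flip (bir a p)) = flip p" by (rule bir_flip_bir[OF a pR aff R])
  have "itin a (\<lambda>k. w (- int k + 1)) (flip (bir a p))"
    unfolding itin_def
  proof
    fix k
    show "(bir a ^^ k) (flip (bir a p)) \<in> Rect (w (- int k + 1)) \<and> determinate a ((bir a ^^ k) (flip (bir a p)))"
    proof (cases k)
      case 0
      then show ?thesis using R aff affine_Rect_determinate[of "flip (bir a p)"] by auto
    next
      case (Suc j)
      have "(bir a ^^ k) (flip (bir a p)) = (bir a ^^ j) (flip p)"
        by (simp add: Suc funpow_swap1 ff del: funpow.simps) (simp add: funpow_swap1 ff)
      then show ?thesis using p Suc by (simp add: biitin_def itin_def)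
    qed
  qed
  then show ?thesis using i1 aff unfolding biitin_def by simp
qed

text \<open>
  Order the points from left to right. If the slopes seen from \<open>(1, 0)\<close> show that the pair is not in
  the stable relation, then the comparison of these slopes is, after one step, the unstable
  relation between the images. The stable relation is the unstable one for the reflected pair, to which
  the backward itineraries apply.
\<close>

lemma double_zero_at_0_unique:
  assumes a: "a < -1" and w: "w \<in> words" and w0: "w 0 = 0" and w1: "w 1 = 0"
    and p: "biitin a w p" and q: "biitin a w q"
  shows "p = q"
proof -
  have aux: False
    if p: "biitin a w (Some x1, Some y1)" and q: "biitin a w (Some x2, Some y2)"
      and ne: "x1 \<noteq> x2 \<or> y1 \<noteq> y2" and le: "x1 < x2 \<or> x1 = x2 \<and> y2 \<le> y1" for x1 y1 x2 y2
  proof -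
    let ?v = "\<lambda>k. w (int k)" and ?v' = "\<lambda>k. w (- int k)"
    have it: "itin a ?v (Some x1, Some y1)" "itin a ?v (Some x2, Some y2)"
      and it': "itin a ?v' (Some (- y1), Some (- x1))" "itin a ?v' (Some (- y2), Some (- x2))"
      using p q by (auto simp: biitin_def)
    have v: "golden ?v" "golden ?v'" using golden_words[OF w] .
    have v01: "?v 0 = 0" "?v (Suc 0) = 0" "?v' 0 = 0" using w0 w1 by auto
    have R: "1 \<le> x1" "1 \<le> x2" "y1 \<le> -1" "y2 \<le> -1"
      using it[THEN itin_head] w0 by (auto simp: Rect_iff)
    \<comment> \<open>the failure of the stable relation, since both backward itineraries are given\<close>
    have nS: "\<not> (y2 \<le> y1 \<and> - y1 * (x2 - 1) \<le> - y2 * (x1 - 1))"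
    proof
      assume "y2 \<le> y1 \<and> - y1 * (x2 - 1) \<le> - y2 * (x1 - 1)"
      then show False using no_unstable_pair[OF a it' v(2) v01(3)] ne le by auto
    qed
    have x12: "x1 < x2"
    proof (rule ccontr)
      assume "\<not> x1 < x2"
      then have "x1 = x2" "y2 \<le> y1" using le by auto
      then show False using nS R by (auto simp: mult_right_mono)
    qed
    have S: "- y2 * (x1 - 1) < - y1 * (x2 - 1)"
    proof (cases "y2 \<le> y1")
      case False
      then have "- y2 * (x1 - 1) \<le> - y2 * (x2 - 1)" "- y2 * (x2 - 1) < - y1 * (x2 - 1)"
        using R x12 by (auto intro: mult_left_mono mult_strict_right_mono)
      then show ?thesis by simp
    qed (use nS in auto)
    note u2 = affine_step_00[OF a it(2) v01(1,2)]
    have x2: "x2 \<noteq> 1" using x12 R by simp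
    have "x1 \<noteq> 1"
    proof
      assume "x1 = 1"
      then have "bir a (Some x1, Some y1) = (None, Some a)" using R by simp
      then have "itin a (\<lambda>k. ?v (Suc k)) (None, Some a)" using itin_shift[OF it(1)] by simp
      then show False
        using affine_not_infinite_itin[OF a golden_shift[OF v(1)] itin_shift[OF it(2), unfolded u2(1)[OF x2]] _ order_refl]
        by blast
    qed
    note u1 = affine_step_00[OF a it(1) v01(1,2) this]
    have "spread 1 (Some (y2 * (x2 + a) / (x2 - 1)), Some (x2 + a - 1))
                  (Some (y1 * (x1 + a) / (x1 - 1)), Some (x1 + a - 1))"
      using u1 u2[OF x2] x12 S by (intro spread_image_00) auto
    then show False
      by (cases rule: spread.cases)
        (use no_unstable_pair[OF a itin_shift[OF it(2), unfolded u2(1)[OF x2]] itin_shift[OF it(1), unfolded u1(1)]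
          golden_shift[OF v(1)] v01(2)] x12 in auto)
  qed
  obtain x1 y1 x2 y2 where pq: "p = (Some x1, Some y1)" "q = (Some x2, Some y2)"
    using p q by (auto simp: biitin_def affine_pts_iff)
  show ?thesis
  proof (rule ccontr)
    assume "p \<noteq> q"
    then have ne: "x1 \<noteq> x2 \<or> y1 \<noteq> y2" using pq by auto
    have "(x1 < x2 \<or> x1 = x2 \<and> y2 \<le> y1) \<or> (x2 < x1 \<or> x2 = x1 \<and> y1 \<le> y2)" by linarith
    then show False
      using aux[OF p[unfolded pq] q[unfolded pq]] aux[OF q[unfolded pq] p[unfolded pq]] ne by auto
  qed
qed

lemma affine_step:
  assumes a: "a < -1" and w: "golden w" and p: "p \<in> affine_pts" "itin a w p"
    and nz: "w 0 \<noteq> 0 \<or> w (Suc 0) \<noteq> 0"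
  shows "bir a p \<in> affine_pts"
proof -
  obtain x y where xy: "p = (Some x, Some y)" using p by (auto simp: affine_pts_iff)
  have "w 0 \<in> {0,1}" "w (Suc 0) \<in> {0,1}" using w by (auto simp: golden_def)
  then consider "w 0 = 0" "w (Suc 0) = 1" | "w 0 = 1" using nz by auto
  then show ?thesis
    using step_01(1)[OF a p(2)[unfolded xy]] step_10(1)[OF p(2)[unfolded xy]]
    by cases (auto simp: xy affine_pts_iff)
qed

text \<open>
  The word contains a double zero at some nonnegative time, because the forward orbit starts in the
  plane; before the first one the orbits stay in the plane, so that both points can be moved there.
\<close>

lemma affine_word_unique:
  assumes a: "a < -1" and w: "w \<in> words" and p: "biitin a w p" and q: "biitin a w q"
  shows "p = q"
proof -
  have "\<exists>k. w (int k) = 0 \<and> w (int (Suc k)) = 0"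
    using ex_double_zero[OF a _ golden_words(1)[OF w]] p by (auto simp: biitin_def affine_pts_iff)
  then obtain m where "w (int m) = 0" "w (int m + 1) = 0" by (auto simp: algebra_simps)
  then show ?thesis using w p q
  proof (induction m arbitrary: w p q)
    case 0
    then show ?case using double_zero_at_0_unique[OF a] by simp
  next
    case (Suc m)
    show ?case
    proof (cases "w 0 = 0 \<and> w 1 = 0")
      case True
      then show ?thesis using double_zero_at_0_unique[OF a] Suc.prems by blast
    next
      case False
      have p': "p \<in> affine_pts" "itin a (\<lambda>k. w (int k)) p" and q': "q \<in> affine_pts" "itin a (\<lambda>k. w (int k)) q"
        using Suc.prems by (auto simp: biitin_def)
      have aff: "bir a p \<in> affine_pts" "bir a q \<in> affine_pts"
        using affine_step[OF a golden_words(1)[OF Suc.prems(3)]] p' q' False by auto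
      have "bir a p = bir a q"
        using Suc.IH[OF _ _ words_shift[OF Suc.prems(3)] biitin_shift[OF a Suc.prems(4) aff(1)]
            biitin_shift[OF a Suc.prems(5) aff(2)]] Suc.prems(1,2) by (simp add: algebra_simps)
      moreover have "bir a (flip (bir a p)) = flip p" "bir a (flip (bir a q)) = flip q"
        using bir_flip_bir[OF a] p' q' aff itin_head itin_head_Suc by metis+
      ultimately show ?thesis by (metis flip_flip)
    qed
  qed
qed

section \<open>Orbits near infinity\<close>

definition near_infinity :: "real \<Rightarrow> torus set" where
  "near_infinity M = insert None (Some ` {x. M < \<bar>x\<bar>}) \<times> insert None (Some ` {x. M < \<bar>x\<bar>})"

lemma near_infinity_iff:
  "(Some x, Some y) \<in> near_infinity M \<longleftrightarrow> M < \<bar>x\<bar> \<and> M < \<bar>y\<bar>"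
  "(Some x, None) \<in> near_infinity M \<longleftrightarrow> M < \<bar>x\<bar>"
  "(None, Some y) \<in> near_infinity M \<longleftrightarrow> M < \<bar>y\<bar>"
  by (auto simp: near_infinity_def)

lemma flip_near_infinity [simp]: "flip p \<in> near_infinity M \<longleftrightarrow> p \<in> near_infinity M"
  by (cases p rule: torus_cases) (auto simp: near_infinity_def image_iff)

text \<open>
  A passage from \<open>Rect 0\<close> to \<open>Rect 0\<close> needs \<open>1 \<le> x \<le> -a\<close> and ends with \<open>a \<le> y' \<le> -1\<close>, so neither its
  start nor its end has both coordinates large. On the lines at infinity only the fixed point
  \<open>(\<infinity>, \<infinity>)\<close> makes such a passage inside the neighbourhood.
\<close>

lemma no_00_near_infinity:
  assumes a: "a < -1" and u: "determinate a u" "u \<in> Rect 0" "bir a u \<in> Rect 0" "u \<noteq> (None, None)"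
  shows "u \<notin> near_infinity (- a)" "bir a u \<notin> near_infinity (- a)"
proof -
  have "u \<notin> near_infinity (- a) \<and> bir a u \<notin> near_infinity (- a)"
  proof (cases u rule: torus_cases)
    case (1 x y)
    show ?thesis
    proof (cases "x = 1")
      case True
      then show ?thesis using u a 1 by (auto simp: Rect_iff near_infinity_iff)
    next
      case False
      then show ?thesis using u a 1 by (auto simp: Rect_iff near_infinity_iff)
    qed
  next
    case (2 x)
    then show ?thesis using u a by (auto simp: Rect_iff near_infinity_iff determinate_def)
  next
    case (3 y)
    then show ?thesis using u a by (auto simp: Rect_iff near_infinity_iff)
  qed (use u in simp)
  then show "u \<notin> near_infinity (- a)" "bir a u \<notin> near_infinity (- a)" by auto
qed

text \<open>
  An affine point enters the lines at infinity at \<open>(\<infinity>, a)\<close>, and from then on the finite coordinate never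
  increases. So this set contains the forward orbit.
\<close>

definition reach :: "real \<Rightarrow> torus set" where
  "reach a = affine_pts \<union> {(None, Some c) | c. c \<le> a} \<union> {(Some c, None) | c. c \<le> a}"

lemma bir_reach:
  assumes "a < -1" "p \<in> reach a" "determinate a p"
  shows "bir a p \<in> reach a"
  using assms by (cases p rule: torus_cases) (auto simp: reach_def affine_pts_iff determinate_def)

lemma orbit_reach:
  assumes "a < -1" "p \<in> affine_pts" "itin a w p"
  shows "(bir a ^^ k) p \<in> reach a"
proof (induction k)
  case 0
  then show ?case using assms by (simp add: reach_def)
next
  case (Suc k)
  then show ?case using bir_reach[OF assms(1) Suc] assms(3) by (simp add: itin_def)
qed

lemma infinity_not_reach: "(None, None) \<notin> reach a"
  by (auto simp: reach_def affine_pts_def)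

text \<open>
  Expressing the backward half through the reflection makes both halves forward orbits, controlled by
  \<open>itin\<close>. For the points in question this is the two-sided orbit (\<open>bir_iter_orb\<close>).
\<close>

definition orb :: "real \<Rightarrow> int \<Rightarrow> torus \<Rightarrow> torus" where
  "orb a n p = (if n \<ge> 0 then (bir a ^^ nat n) p else flip ((bir a ^^ nat (- n)) (flip p)))"

lemma orb_Rect:
  assumes "biitin a w p"
  shows "orb a n p \<in> Rect (w n)"
proof (cases "n \<ge> 0")
  case True
  then show ?thesis using assms unfolding orb_def biitin_def itin_def by (metis nat_0_le)
next
  case False
  then have "n = - int (nat (- n))" by simp
  then show ?thesis using assms False unfolding orb_def biitin_def itin_def by (metis flip_Rect)
qed

lemma orb_not_infinity:
  assumes "a < -1" "biitin a w p"
  shows "orb a n p \<noteq> (None, None)"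
proof
  assume "orb a n p = (None, None)"
  then have "\<exists>k. (bir a ^^ k) p = (None, None) \<or> (bir a ^^ k) (flip p) = (None, None)"
    unfolding orb_def by (metis flip_flip flip_simps(4))
  then show False using orbit_reach[OF assms(1)] assms(2) infinity_not_reach unfolding biitin_def
    by (metis flip_affine)
qed

text \<open>
  Consecutive points of the two-sided orbit are related by \<open>f\<close> or, read backwards, by the reflected map.
  Both can be needed: \<open>f\<close> does not recover the backward orbit of a point of the line
  \<open>y = -1\<close>, whose predecessor \<open>(-a, \<infinity>)\<close> is an indeterminacy point of \<open>f\<close>.
\<close>

lemma orb_link:
  assumes "biitin a w p"
  shows "determinate a (orb a n p) \<and> orb a (n + 1) p = bir a (orb a n p)
    \<or> determinate a (flip (orb a (n + 1) p)) \<and> flip (orb a n p) = bir a (flip (orb a (n + 1) p))"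
proof (cases "n \<ge> 0")
  case True
  then have "nat (n + 1) = Suc (nat n)" by simp
  then show ?thesis using True assms unfolding orb_def biitin_def itin_def by simp
next
  case False
  then have 1: "nat (- n) = Suc (nat (- (n + 1)))" by simp
  have 2: "flip (orb a (n + 1) p) = (bir a ^^ nat (- (n + 1))) (flip p)"
    using False by (auto simp: orb_def)
  have "flip (orb a n p) = bir a (flip (orb a (n + 1) p))"
    unfolding 2 using False 1 by (simp add: orb_def)
  moreover have "determinate a (flip (orb a (n + 1) p))" unfolding 2
    using assms by (simp add: biitin_def itin_def)
  ultimately show ?thesis by blast
qed

lemma no_00_orb_near_infinity:
  assumes a: "a < -1" and p: "biitin a w p" and w: "w n = 0" "w (n + 1) = 0"
  shows "orb a n p \<notin> near_infinity (- a)" "orb a (n + 1) p \<notin> near_infinity (- a)"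
proof -
  have R: "orb a n p \<in> Rect 0" "orb a (n + 1) p \<in> Rect 0" using orb_Rect[OF p] w by metis+
  have N: "orb a n p \<noteq> (None, None)" "flip (orb a (n + 1) p) \<noteq> (None, None)"
    using orb_not_infinity[OF a p] by (metis flip_flip flip_simps(4))+
  from orb_link[OF p, of n]
  have "orb a n p \<notin> near_infinity (- a) \<and> orb a (n + 1) p \<notin> near_infinity (- a)"
  proof
    assume "determinate a (orb a n p) \<and> orb a (n + 1) p = bir a (orb a n p)"
    then show ?thesis using no_00_near_infinity[OF a, of "orb a n p"] R N by simp
  next
    assume "determinate a (flip (orb a (n + 1) p)) \<and> flip (orb a n p) = bir a (flip (orb a (n + 1) p))"
    then show ?thesis
      using no_00_near_infinity[OF a, of "flip (orb a (n + 1) p)"] R N by (metis flip_Rect flip_near_infinity)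
  qed
  then show "orb a n p \<notin> near_infinity (- a)" "orb a (n + 1) p \<notin> near_infinity (- a)" by auto
qed

text \<open>
  If the words differ at time \<open>n\<close>, one of the letters is \<open>1\<close> and is followed and preceded by \<open>0\<close>. The other
  one is \<open>0\<close> and, the orbit being near infinity, has no \<open>0\<close> as a neighbour. So the words differ at all
  times and both alternate, which an affine point excludes.
\<close>

lemma not_always_near_infinity:
  assumes a: "a < -1" and w: "w \<in> words" "w' \<in> words"
    and p: "biitin a w p" and q: "biitin a w' q" and k: "w k \<noteq> w' k"
    and near: "\<And>n. w n \<noteq> w' n \<Longrightarrow> orb a n p \<in> near_infinity (- a) \<and> orb a n q \<in> near_infinity (- a)"
  shows False
proof -
  have up: "w n + w (n + 1) = 1 \<and> w' n + w' (n + 1) = 1" if "w n \<noteq> w' n" for n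
    using near[OF that] that words_values[OF w(1), of n] words_values[OF w(2), of n]
      words_values[OF w(1), of "n + 1"] words_values[OF w(2), of "n + 1"]
      words_no_11[OF w(1), of n] words_no_11[OF w(2), of n]
      no_00_orb_near_infinity(1)[OF a p, of n] no_00_orb_near_infinity(1)[OF a q, of n] by auto
  have down: "w (n - 1) \<noteq> w' (n - 1)" if "w n \<noteq> w' n" for n
    using near[OF that] that words_values[OF w(1), of n] words_values[OF w(2), of n]
      words_values[OF w(1), of "n - 1"] words_values[OF w(2), of "n - 1"]
      words_no_11'[OF w(1), of n] words_no_11'[OF w(2), of n]
      no_00_orb_near_infinity(2)[OF a p, of "n - 1"] no_00_orb_near_infinity(2)[OF a q, of "n - 1"] by auto
  have all: "w n \<noteq> w' n" for n
  proof (induction n rule: int_induct[of _ k])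
    case (step1 i)
    then show ?case using up[of i] by linarith
  qed (use k down in auto)
  have "w (int j) + w (int (Suc j)) = 1" for j using up[OF all, of "int j"] by (simp add: add.commute)
  moreover have "\<exists>j. w (int j) = 0 \<and> w (int (Suc j)) = 0"
    using ex_double_zero[OF a _ golden_words(1)[OF w(1)]] p by (auto simp: biitin_def affine_pts_iff)
  ultimately show False by (metis add_0 zero_neq_one)
qed

section \<open>Points with a prescribed finite itinerary\<close>

definition open_Rect :: "nat \<Rightarrow> torus set" where
  "open_Rect i = (if i = 0 then Some ` {1<..} \<times> Some ` {..<-1} else Some ` {..<0} \<times> Some ` {0<..})"

text \<open>
  A neighbourhood of the point at infinity contains the complement of a bounded set, so infinity is not
  interior to a set with unbounded complement, such as a half-line with its end at infinity.
\<close>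

lemma Alexandroff_interior_subset:
  assumes S: "\<not> bounded (- S)"
  shows "Alexandroff_compactification euclideanreal interior_of insert None (Some ` S) \<subseteq> Some ` interior S"
proof
  fix c assume "c \<in> Alexandroff_compactification euclideanreal interior_of insert None (Some ` S)"
  then obtain T where T: "openin (Alexandroff_compactification euclideanreal) T" "c \<in> T" "T \<subseteq> insert None (Some ` S)"
    by (auto simp: interior_of_def)
  from T(1) consider U where "open U" "T = Some ` U" | C where "compact C" "T = insert None (Some ` (- C))"
    by (auto simp: openin_Alexandroff_compactification Compl_eq_Diff_UNIV)
  then show "c \<in> Some ` interior S"
  proof cases
    case 1
    then have "U \<subseteq> S" using T(3) by auto
    then show ?thesis using 1 T(2) interior_maximal by blast
  next
    case 2
    then have "- S \<subseteq> C" using T(3) by auto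
    then show ?thesis using S 2(1) compact_imp_bounded bounded_subset by blast
  qed
qed

lemma unbounded_half_lines: "\<not> bounded (- {c::real..})" "\<not> bounded (- {..c::real})"
proof -
  have 1: "- {c..} = {..<c}" "- {..c} = {c<..}" by auto
  have 2: "\<exists>x<c. B < \<bar>x\<bar>" "\<exists>x>c. B < \<bar>x\<bar>" for B :: real
    by (rule exI[of _ "- \<bar>c\<bar> - \<bar>B\<bar> - 1"], linarith) (rule exI[of _ "\<bar>c\<bar> + \<bar>B\<bar> + 1"], linarith)
  show "\<not> bounded (- {c::real..})" "\<not> bounded (- {..c::real})"
    unfolding 1 bounded_iff using 2 by (auto simp: not_le)
qed

lemma interior_Rect_subset: "torus_top interior_of Rect i \<subseteq> open_Rect i"
proof -
  note A = Alexandroff_interior_subset[OF unbounded_half_lines(1)] Alexandroff_interior_subset[OF unbounded_half_lines(2)]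
  show ?thesis
  proof (cases "i = 0")
    case True
    then show ?thesis unfolding torus_top_def Rect_def open_Rect_def
      using A(1)[of 1] A(2)[of "-1"] by (simp only: if_True simp_thms interior_of_Times interior_real_atLeast interior_real_atMost) (intro Sigma_mono; simp)
  next
    case False
    then show ?thesis unfolding torus_top_def Rect_def open_Rect_def
      using A(2)[of 0] A(1)[of 0] by (simp only: if_False False interior_of_Times interior_real_atLeast interior_real_atMost) (intro Sigma_mono; simp)
  qed
qed

lemma flip_open_Rect [simp]: "flip p \<in> open_Rect i \<longleftrightarrow> p \<in> open_Rect i"
  by (cases p rule: torus_cases) (auto simp: open_Rect_def image_iff)

lemma bir_inv_flip:
  assumes "determinate a p"
  shows "bir_inv a (flip p) = flip (bir a p)"
proof (cases p rule: torus_cases)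
  case (1 x y)
  show ?thesis
  proof (cases "x = 1")
    case False
    then have "- x + 1 \<noteq> 0" "x - 1 \<noteq> 0" by auto
    then have "- y * (- x - a) / (- x + 1) = - (y * (x + a) / (x - 1))"
      by (simp add: divide_simps) (simp add: algebra_simps)
    then show ?thesis using 1 False by simp
  qed (use 1 assms in \<open>auto simp: determinate_def\<close>)
next
  case (2 x)
  then show ?thesis using assms by (auto simp: determinate_def)
qed auto

text \<open>
  The inverse map sends this set into itself. A backward orbit that enters it never comes back to the
  interior of a rectangle.
\<close>

definition escape_set :: "real \<Rightarrow> torus set" where
  "escape_set a = Some ` {0<..} \<times> Some ` {0..} \<union> Some ` {- a..} \<times> {None} \<union> {None} \<times> Some ` {- a..}"

lemma escape_set_iff:
  "(Some x, Some y) \<in> escape_set a \<longleftrightarrow> 0 < x \<and> 0 \<le> y"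
  "(Some x, None) \<in> escape_set a \<longleftrightarrow> - a \<le> x"
  "(None, Some y) \<in> escape_set a \<longleftrightarrow> - a \<le> y"
  "(None, None) \<notin> escape_set a"
  by (auto simp: escape_set_def)

text \<open>
  The positions of a backward orbit that starts inside a rectangle and has not escaped.
\<close>

definition core_set :: "torus set" where
  "core_set = {(Some x, Some y) | x y. x \<le> 0 \<and> 0 < y \<or> 1 < x \<and> y < 0}"

lemma open_Rect_core: "open_Rect i \<subseteq> core_set"
  by (auto simp: open_Rect_def core_set_def split: if_splits)

lemma core_escape_disjoint: "p \<in> core_set \<Longrightarrow> p \<notin> escape_set a"
  by (auto simp: core_set_def escape_set_iff)

lemma bir_inv_escape:
  assumes "a < -1" "p \<in> escape_set a"
  shows "bir_inv a p \<in> escape_set a"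
  using assms by (cases p rule: torus_cases) (auto simp: escape_set_iff)

text \<open>
  The lines \<open>y = -1\<close> and \<open>y = a\<close>, which the inverse map contracts to \<open>(-a, \<infinity>)\<close> and to \<open>(1, 0)\<close>, are
  thereby sent into the escaping set. Away from them the map undoes its inverse.
\<close>

lemma bir_inv_core:
  assumes a: "a < -1" and p: "p \<in> core_set"
  shows "bir_inv a p \<in> core_set \<and> bir a (bir_inv a p) = p \<or> bir_inv a p \<in> escape_set a"
proof -
  obtain x y where xy: "p = (Some x, Some y)" "x \<le> 0 \<and> 0 < y \<or> 1 < x \<and> y < 0"
    using p by (auto simp: core_set_def)
  show ?thesis
  proof (cases "y = -1 \<or> y = a")
    case True
    then show ?thesis using a xy by (auto simp: escape_set_iff)
  next
    case False
    define y' where "y' = x * (y - a) / (y + 1)"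
    have e: "bir_inv a p = (Some (y + 1 - a), Some y')" using False xy by (simp add: y'_def)
    have nz: "y + 1 \<noteq> 0" "y - a \<noteq> 0" using False by auto
    have "y' * (y + 1 - a + a) / (y + 1 - a - 1) = x" using nz by (simp add: y'_def)
    then have b: "bir a (bir_inv a p) = p" using nz unfolding e xy by simp
    from xy(2) consider "x < 0 \<and> 0 < y" | "x = 0" "0 < y" | "1 < x" "y < a" | "1 < x" "a < y" "y < -1"
      | "1 < x" "a < y" "-1 < y" "y < 0" using False by linarith
    then show ?thesis
    proof cases
      case 1
      then have "y' < 0" unfolding y'_def using a by (intro divide_neg_pos mult_neg_pos) auto
      then show ?thesis using b 1 a unfolding e by (auto simp: core_set_def)
    next
      case 2
      then show ?thesis using a unfolding e by (auto simp: y'_def escape_set_iff)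
    next
      case 3
      then have y': "0 < y'" unfolding y'_def using a by (intro divide_neg_neg mult_pos_neg) auto
      then show ?thesis using b unfolding e
        by (cases "y + 1 - a \<le> 0") (auto simp: core_set_def escape_set_iff)
    next
      case 4
      then have y': "y' < 0" unfolding y'_def by (intro divide_pos_neg mult_pos_pos) auto
      then show ?thesis using b 4 unfolding e by (auto simp: core_set_def)
    next
      case 5
      then have y': "0 < y'" unfolding y'_def by (intro divide_pos_pos mult_pos_pos) auto
      then show ?thesis using 5 unfolding e by (auto simp: escape_set_iff)
    qed
  qed
qed

lemma bir_bir_inv_iterate:
  assumes a: "a < -1" and z: "z \<in> core_set"
  shows "(bir_inv a ^^ k) z \<in> core_set \<and> (bir a ^^ k) ((bir_inv a ^^ k) z) = z \<or> (bir_inv a ^^ k) z \<in> escape_set a"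
proof (induction k)
  case 0
  then show ?case using z by simp
next
  case (Suc k)
  let ?u = "(bir_inv a ^^ k) z"
  from Suc show ?case
  proof
    assume u: "?u \<in> core_set \<and> (bir a ^^ k) ?u = z"
    from bir_inv_core[OF a conjunct1[OF u]] show ?thesis using u by (auto simp: funpow_swap1)
  next
    assume "?u \<in> escape_set a"
    then show ?thesis using bir_inv_escape[OF a] by simp
  qed
qed

lemma core_escape_determinate:
  assumes "a < -1" "flip p \<in> core_set \<union> escape_set a"
  shows "determinate a p"
  using assms by (cases p rule: torus_cases) (auto simp: determinate_def core_set_def escape_set_iff)

lemma flip_bir_iterate:
  assumes a: "a < -1" and z: "flip z \<in> core_set"
  shows "flip ((bir a ^^ k) z) = (bir_inv a ^^ k) (flip z)"
proof (induction k)
  case (Suc k)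
  have "(bir_inv a ^^ k) (flip z) \<in> core_set \<union> escape_set a"
    using bir_bir_inv_iterate[OF a z] by blast
  then have "determinate a ((bir a ^^ k) z)" using core_escape_determinate[OF a] Suc by simp
  then show ?case using bir_inv_flip[of a "(bir a ^^ k) z"] Suc by simp
qed simp

text \<open>
  The points whose itinerary agrees with \<open>w\<close> for the times \<open>-n, \<dots>, n\<close>, formulated with preimages
  rather than with images. Points given by images belong to it because a point inside a rectangle has not
  escaped, so that the iterates of \<open>f\<close> and \<open>f\<^sup>-\<^sup>1\<close> on its way cancel.
\<close>

definition Block :: "real \<Rightarrow> (int \<Rightarrow> nat) \<Rightarrow> nat \<Rightarrow> torus set" where
  "Block a w n = {s. \<forall>k\<le>n. (bir a ^^ k) s \<in> open_Rect (w (int k)) \<and> (bir a ^^ k) (flip s) \<in> open_Rect (w (- int k))}"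

lemma Rect_block_subset:
  assumes a: "a < -1"
  shows "Rect_block a w n n \<subseteq> torus_top closure_of Block a w n"
  unfolding Rect_block_def
proof (rule closure_of_mono, rule subsetI)
  fix s assume "s \<in> (\<Inter>k\<in>{- int n..int n}. bir_iter a (- k) ` (torus_top interior_of Rect (w k)))"
  then have s: "s \<in> bir_iter a (- k) ` open_Rect (w k)" if "- int n \<le> k" "k \<le> int n" for k
    using that interior_Rect_subset[of "w k"] by fastforce
  have "s \<in> open_Rect (w 0)" using s[of 0] by (auto simp: bir_iter_def)
  then have sc: "s \<in> core_set" "flip s \<in> core_set" using open_Rect_core flip_open_Rect by blast+
  have "(bir a ^^ k) s \<in> open_Rect (w (int k))" if k: "k \<le> n" for k
  proof -
    obtain z where z: "z \<in> open_Rect (w (int k))" "s = (bir_inv a ^^ k) z"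
      using s[of "int k"] k by (cases "k = 0") (auto simp: bir_iter_def)
    then have "(bir a ^^ k) s = z"
      using bir_bir_inv_iterate[OF a, of z k] open_Rect_core core_escape_disjoint[OF sc(1)] by blast
    then show ?thesis using z by simp
  qed
  moreover have "(bir a ^^ k) (flip s) \<in> open_Rect (w (- int k))" if k: "k \<le> n" for k
  proof -
    obtain z where z: "z \<in> open_Rect (w (- int k))" "s = (bir a ^^ k) z"
      using s[of "- int k"] k by (auto simp: bir_iter_def)
    then have fz: "flip z \<in> core_set" using open_Rect_core flip_open_Rect by blast
    have "flip s = (bir_inv a ^^ k) (flip z)" using flip_bir_iterate[OF a fz] z by simp
    then have "(bir a ^^ k) (flip s) = flip z"
      using bir_bir_inv_iterate[OF a fz, of k] core_escape_disjoint[OF sc(2)] by metis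
    then show ?thesis using z by simp
  qed
  ultimately show "s \<in> Block a w n" by (simp add: Block_def)
qed

section \<open>Limits of orbits\<close>

text \<open>
  Orbit segments of points of \<open>Block\<close> are affine, so their convergence in the torus can be expressed by
  ordinary limits of real functions: a coordinate tends to a real number or its absolute value
  tends to infinity.
\<close>

definition coord_lim :: "('i \<Rightarrow> real) \<Rightarrow> real option \<Rightarrow> 'i filter \<Rightarrow> bool" where
  "coord_lim X c F = (case c of Some x \<Rightarrow> (X \<longlongrightarrow> x) F | None \<Rightarrow> filterlim X at_infinity F)"

definition torus_lim :: "('i \<Rightarrow> torus) \<Rightarrow> torus \<Rightarrow> 'i filter \<Rightarrow> bool" where
  "torus_lim g p F \<longleftrightarrow> coord_lim (\<lambda>i. the (fst (g i))) (fst p) F \<and> coord_lim (\<lambda>i. the (snd (g i))) (snd p) F"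

lemma torus_lim_simps:
  "torus_lim g (Some x, Some y) F \<longleftrightarrow> ((\<lambda>i. the (fst (g i))) \<longlongrightarrow> x) F \<and> ((\<lambda>i. the (snd (g i))) \<longlongrightarrow> y) F"
  "torus_lim g (Some x, None) F \<longleftrightarrow> ((\<lambda>i. the (fst (g i))) \<longlongrightarrow> x) F \<and> filterlim (\<lambda>i. the (snd (g i))) at_infinity F"
  "torus_lim g (None, Some y) F \<longleftrightarrow> filterlim (\<lambda>i. the (fst (g i))) at_infinity F \<and> ((\<lambda>i. the (snd (g i))) \<longlongrightarrow> y) F"
  by (simp_all add: torus_lim_def coord_lim_def)

lemma coord_lim_cong:
  assumes "eventually (\<lambda>i. X i = Y i) F"
  shows "coord_lim X c F \<longleftrightarrow> coord_lim Y c F"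
  unfolding coord_lim_def using tendsto_cong[OF assms] filterlim_cong[OF refl refl assms]
  by (auto split: option.split)

text \<open>
  Continuity of \<open>f\<close> at the points of \<open>reach a\<close> other than the indeterminacy points. At \<open>(1, y)\<close> the denominator
  tends to \<open>0\<close> and the numerator to \<open>y (1 + a) \<noteq> 0\<close>; at \<open>(\<infinity>, y)\<close> the factor \<open>(x + a) / (x - 1)\<close> tends
  to \<open>1\<close>; at \<open>(x, \<infinity>)\<close> it tends to a nonzero number, since \<open>x \<le> a < 0\<close>.
\<close>

lemma torus_lim_bir:
  assumes a: "a < -1" and g: "torus_lim g p F" "eventually (\<lambda>i. g i \<in> open_Rect k) F"
    and p: "p \<in> reach a" "determinate a p"
  shows "torus_lim (\<lambda>i. bir a (g i)) (bir a p) F"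
proof -
  define X where "X = (\<lambda>i. the (fst (g i)))"
  define Y where "Y = (\<lambda>i. the (snd (g i)))"
  have gXY: "eventually (\<lambda>i. g i = (Some (X i), Some (Y i)) \<and> X i \<noteq> 1) F"
    using g(2) by (rule eventually_mono) (auto simp: open_Rect_def X_def Y_def split: if_splits)
  then have X1: "eventually (\<lambda>i. X i \<noteq> 1) F" by (rule eventually_mono) auto
  have 1: "eventually (\<lambda>i. the (fst (bir a (g i))) = Y i * (X i + a) / (X i - 1)) F"
    and 2: "eventually (\<lambda>i. the (snd (bir a (g i))) = X i + a - 1) F"
    by (rule eventually_mono[OF gXY], simp)+
  have lim: "torus_lim (\<lambda>i. bir a (g i)) q F \<longleftrightarrow>
     coord_lim (\<lambda>i. Y i * (X i + a) / (X i - 1)) (fst q) F \<and> coord_lim (\<lambda>i. X i + a - 1) (snd q) F" for q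
    unfolding torus_lim_def coord_lim_cong[OF 1] coord_lim_cong[OF 2] ..
  have addinf: "filterlim (\<lambda>i. X i + c) at_infinity F" if "filterlim X at_infinity F" for c
    by (rule tendsto_add_filterlim_at_infinity'[OF that tendsto_const])
  have p': "p \<noteq> (None, None)" using p(1) infinity_not_reach by metis
  show ?thesis
  proof (cases p rule: torus_cases)
    case (1 x y)
    then have XY: "(X \<longlongrightarrow> x) F" "(Y \<longlongrightarrow> y) F" using g(1) by (simp_all add: torus_lim_simps X_def Y_def)
    show ?thesis
    proof (cases "x = 1")
      case False
      then show ?thesis unfolding lim 1 by (auto simp: coord_lim_def intro!: tendsto_eq_intros XY)
    next
      case True
      then have y: "y \<noteq> 0" using p(2) 1 by (simp add: determinate_def)
      have "filterlim (\<lambda>i. X i - 1) (at 0) F"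
        using X1 by (intro filterlim_atI) (auto intro!: tendsto_eq_intros XY simp: True)
      then have inv: "filterlim (\<lambda>i. inverse (X i - 1)) at_infinity F"
        by (rule filterlim_compose[OF filterlim_inverse_at_infinity])
      have num: "((\<lambda>i. Y i * (X i + a)) \<longlongrightarrow> y * (1 + a)) F"
        by (auto intro!: tendsto_eq_intros XY simp: True)
      have "y * (1 + a) \<noteq> 0" using y a by simp
      then have "filterlim (\<lambda>i. Y i * (X i + a) * inverse (X i - 1)) at_infinity F"
        by (rule tendsto_mult_filterlim_at_infinity[OF num _ inv])
      then have "filterlim (\<lambda>i. Y i * (X i + a) / (X i - 1)) at_infinity F"
        by (simp only: divide_inverse)
      moreover have "((\<lambda>i. X i + a - 1) \<longlongrightarrow> a) F" by (auto intro!: tendsto_eq_intros XY simp: True)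
      ultimately show ?thesis unfolding lim 1 using True y by (simp add: coord_lim_def)
    qed
  next
    case (2 x)
    then have XY: "(X \<longlongrightarrow> x) F" "filterlim Y at_infinity F" using g(1) by (simp_all add: torus_lim_simps X_def Y_def)
    have x: "x \<le> a" using p(1) 2 by (auto simp: reach_def affine_pts_def)
    have quot: "((\<lambda>i. (X i + a) / (X i - 1)) \<longlongrightarrow> (x + a) / (x - 1)) F"
      using x a by (auto intro!: tendsto_eq_intros XY)
    have "(x + a) / (x - 1) \<noteq> 0" using x a by simp
    then have "filterlim (\<lambda>i. (X i + a) / (X i - 1) * Y i) at_infinity F"
      by (rule tendsto_mult_filterlim_at_infinity[OF quot _ XY(2)])
    then have "filterlim (\<lambda>i. Y i * (X i + a) / (X i - 1)) at_infinity F" by (simp add: mult.commute)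
    moreover have "((\<lambda>i. X i + a - 1) \<longlongrightarrow> x + a - 1) F" by (auto intro!: tendsto_eq_intros XY)
    ultimately show ?thesis unfolding lim 2 using x a by (simp add: coord_lim_def)
  next
    case (3 y)
    then have XY: "filterlim X at_infinity F" "(Y \<longlongrightarrow> y) F" using g(1) by (simp_all add: torus_lim_simps X_def Y_def)
    have van: "((\<lambda>i. (a + 1) / (X i - 1)) \<longlongrightarrow> 0) F"
      using addinf[OF XY(1), of "-1"] by (intro tendsto_divide_0[OF tendsto_const]) simp
    have "((\<lambda>i. Y i * (1 + (a + 1) / (X i - 1))) \<longlongrightarrow> y) F"
      using tendsto_mult[OF XY(2) tendsto_add[OF tendsto_const[of 1] van]] by simp
    moreover have "eventually (\<lambda>i. Y i * (1 + (a + 1) / (X i - 1)) = Y i * (X i + a) / (X i - 1)) F"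
      using X1 by (rule eventually_mono) (simp add: field_simps)
    ultimately have "((\<lambda>i. Y i * (X i + a) / (X i - 1)) \<longlongrightarrow> y) F" using tendsto_cong by fast
    moreover have "filterlim (\<lambda>i. X i + a - 1) at_infinity F"
      using addinf[OF XY(1), of "a - 1"] by (simp add: algebra_simps)
    ultimately show ?thesis unfolding lim 3 by (simp add: coord_lim_def)
  qed (use p' in simp)
qed

lemma torus_lim_Rect:
  assumes F: "F \<noteq> bot" and g: "torus_lim g p F" "eventually (\<lambda>i. g i \<in> open_Rect k) F"
  shows "p \<in> Rect k"
proof -
  have L: "c \<in> insert None (Some ` {l..})" if "coord_lim X c F" "eventually (\<lambda>i. l < X i) F" for X c l
  proof (cases c)
    case (Some x)
    have "eventually (\<lambda>i. l \<le> X i) F" using that(2) by (rule eventually_mono) simp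
    then have "l \<le> x" using that(1) tendsto_lowerbound[OF _ _ F] Some by (simp add: coord_lim_def)
    then show ?thesis using Some by simp
  qed simp
  have U: "c \<in> insert None (Some ` {..l})" if "coord_lim X c F" "eventually (\<lambda>i. X i < l) F" for X c l
  proof (cases c)
    case (Some x)
    have "eventually (\<lambda>i. X i \<le> l) F" using that(2) by (rule eventually_mono) simp
    then have "x \<le> l" using that(1) tendsto_upperbound[OF _ _ F] Some by (simp add: coord_lim_def)
    then show ?thesis using Some by simp
  qed simp
  have e: "eventually (\<lambda>i. if k = 0 then 1 < the (fst (g i)) \<and> the (snd (g i)) < -1
      else the (fst (g i)) < 0 \<and> 0 < the (snd (g i))) F"
    using g(2) by (rule eventually_mono) (auto simp: open_Rect_def split: if_splits)
  have lim: "coord_lim (\<lambda>i. the (fst (g i))) (fst p) F" "coord_lim (\<lambda>i. the (snd (g i))) (snd p) F"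
    using g(1) by (auto simp: torus_lim_def)
  show ?thesis
  proof (cases "k = 0")
    case True
    have "eventually (\<lambda>i. 1 < the (fst (g i))) F" "eventually (\<lambda>i. the (snd (g i)) < -1) F"
      by (rule eventually_mono[OF e], simp add: True)+
    then have "fst p \<in> insert None (Some ` {1..})" "snd p \<in> insert None (Some ` {..-1})"
      using L[OF lim(1)] U[OF lim(2)] by blast+
    then show ?thesis unfolding Rect_def using True by (simp only: if_True mem_Times_iff simp_thms)
  next
    case False
    have "eventually (\<lambda>i. the (fst (g i)) < 0) F" "eventually (\<lambda>i. 0 < the (snd (g i))) F"
      by (rule eventually_mono[OF e], simp add: False)+
    then have "fst p \<in> insert None (Some ` {..0})" "snd p \<in> insert None (Some ` {0..})"
      using U[OF lim(1)] L[OF lim(2)] by blast+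
    then show ?thesis unfolding Rect_def using False by (simp only: if_False mem_Times_iff simp_thms)
  qed
qed

lemma reach_Rect_determinate:
  assumes "a < -1" "p \<in> reach a" "p \<in> Rect k"
  shows "determinate a p"
  using assms affine_Rect_determinate[of p k a] by (auto simp: reach_def determinate_def)

text \<open>
  A limit of orbits stays in \<open>reach a\<close> and in the closed rectangles. These properties exclude the
  indeterminacy points, so the induction continues.
\<close>

lemma limit_orbit:
  assumes a: "a < -1" and F: "F \<noteq> bot" and g: "torus_lim g p F" and p: "p \<in> affine_pts"
    and ev: "eventually (\<lambda>i. \<forall>k\<le>n. (bir a ^^ k) (g i) \<in> open_Rect (w k)) F"
  shows "k \<le> n \<Longrightarrow> torus_lim (\<lambda>i. (bir a ^^ k) (g i)) ((bir a ^^ k) p) F \<and> (bir a ^^ k) p \<in> reach a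
      \<and> (bir a ^^ k) p \<in> Rect (w k) \<and> determinate a ((bir a ^^ k) p)"
proof (induction k)
  case 0
  have "eventually (\<lambda>i. g i \<in> open_Rect (w 0)) F" using ev by (rule eventually_mono) force
  then have "p \<in> Rect (w 0)" using torus_lim_Rect[OF F g] by simp
  moreover have "p \<in> reach a" using p by (simp add: reach_def)
  ultimately show ?case using g reach_Rect_determinate[OF a] by simp
next
  case (Suc k)
  let ?p = "(bir a ^^ k) p"
  have IH: "torus_lim (\<lambda>i. (bir a ^^ k) (g i)) ?p F" "?p \<in> reach a" "determinate a ?p" using Suc by auto
  have evk: "eventually (\<lambda>i. (bir a ^^ j) (g i) \<in> open_Rect (w j)) F" if "j \<le> n" for j
    using ev by (rule eventually_mono) (use that in auto)
  have T: "torus_lim (\<lambda>i. (bir a ^^ Suc k) (g i)) ((bir a ^^ Suc k) p) F"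
    using torus_lim_bir[OF a IH(1) evk IH(2,3)] Suc.prems by simp
  have R: "(bir a ^^ Suc k) p \<in> Rect (w (Suc k))" by (rule torus_lim_Rect[OF F T evk[OF Suc.prems]])
  have "(bir a ^^ Suc k) p \<in> reach a" using bir_reach[OF a IH(2,3)] by simp
  then show ?case using T R reach_Rect_determinate[OF a] by blast
qed

text \<open>
  The limit is taken along the trace on \<open>Block a w n\<close> of the neighbourhood filter of \<open>p\<close>.
\<close>

lemma Rect_word_biitin:
  assumes a: "a < -1" and p: "p \<in> Rect_word a w" "p \<in> affine_pts"
  shows "biitin a w p"
proof -
  obtain x y where xy: "p = (Some x, Some y)" using p(2) by (auto simp: affine_pts_iff)
  have main: "(bir a ^^ n) p \<in> Rect (w (int n)) \<and> determinate a ((bir a ^^ n) p) \<and>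
     (bir a ^^ n) (flip p) \<in> Rect (w (- int n)) \<and> determinate a ((bir a ^^ n) (flip p))" for n
  proof -
    have cl: "p \<in> torus_top closure_of Block a w n"
      using p(1) Rect_block_subset[OF a] unfolding Rect_word_def by blast
    define F where "F = inf (nhdsin torus_top p) (principal (Block a w n))"
    have top: "p \<in> topspace torus_top" using cl by (simp add: in_closure_of)
    have evF: "eventually P F \<longleftrightarrow> (\<exists>T. openin torus_top T \<and> p \<in> T \<and> (\<forall>s\<in>T. s \<in> Block a w n \<longrightarrow> P s))" for P
      unfolding F_def eventually_inf_principal eventually_nhdsin using top by simp
    have F: "F \<noteq> bot"
    proof
      assume "F = bot"
      then have "eventually (\<lambda>_. False) F" by simp
      then obtain T where T: "openin torus_top T" "p \<in> T" "\<forall>s\<in>T. s \<notin> Block a w n" unfolding evF by auto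
      then obtain s where "s \<in> Block a w n" "s \<in> T" using cl unfolding in_closure_of by auto
      then show False using T(3) by simp
    qed
    have B: "eventually (\<lambda>s. s \<in> Block a w n) F"
      unfolding F_def eventually_inf_principal by simp
    have openAll: "openin (Alexandroff_compactification euclideanreal) UNIV"
      using openin_topspace[of "Alexandroff_compactification euclideanreal"] by (simp add: UNIV_option_conv)
    have cont1: "((\<lambda>s. the (fst s)) \<longlongrightarrow> x) F"
    proof (rule topological_tendstoI)
      fix U assume U: "open U" "x \<in> U"
      have "openin torus_top (Some ` U \<times> UNIV)"
        using U openAll by (simp add: torus_top_def openin_prod_Times_iff)
      moreover have "p \<in> Some ` U \<times> UNIV" using U by (simp add: xy)
      moreover have "\<forall>s\<in>Some ` U \<times> UNIV. s \<in> Block a w n \<longrightarrow> the (fst s) \<in> U" by auto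
      ultimately show "eventually (\<lambda>s. the (fst s) \<in> U) F" unfolding evF by blast
    qed
    have cont2: "((\<lambda>s. the (snd s)) \<longlongrightarrow> y) F"
    proof (rule topological_tendstoI)
      fix U assume U: "open U" "y \<in> U"
      have "openin torus_top (UNIV \<times> Some ` U)"
        using U openAll by (simp add: torus_top_def openin_prod_Times_iff)
      moreover have "p \<in> UNIV \<times> Some ` U" using U by (simp add: xy)
      moreover have "\<forall>s\<in>UNIV \<times> Some ` U. s \<in> Block a w n \<longrightarrow> the (snd s) \<in> U" by auto
      ultimately show "eventually (\<lambda>s. the (snd s) \<in> U) F" unfolding evF by blast
    qed
    have fl: "torus_lim (\<lambda>s. s) p F" using cont1 cont2 by (simp add: xy torus_lim_simps)
    have inR: "eventually (\<lambda>s. s \<in> affine_pts) F"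
    proof (rule eventually_mono[OF B])
      fix s assume "s \<in> Block a w n"
      then have "s \<in> open_Rect (w 0)" unfolding Block_def by (auto dest: spec[of _ 0])
      then show "s \<in> affine_pts" by (auto simp: open_Rect_def affine_pts_def split: if_splits)
    qed
    have e: "eventually (\<lambda>s. - the (snd s) = the (fst (flip s))) F"
        "eventually (\<lambda>s. - the (fst s) = the (snd (flip s))) F"
      by (rule eventually_mono[OF inR], force simp: affine_pts_iff)+
    have "torus_lim flip (flip p) F"
      unfolding xy flip_simps torus_lim_simps
      using tendsto_cong[OF e(1)] tendsto_cong[OF e(2)] tendsto_minus[OF cont1] tendsto_minus[OF cont2] by blast
    moreover have "eventually (\<lambda>s. \<forall>k\<le>n. (bir a ^^ k) s \<in> open_Rect (w (int k))) F"
      "eventually (\<lambda>s. \<forall>k\<le>n. (bir a ^^ k) (flip s) \<in> open_Rect (w (- int k))) F"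
      by (rule eventually_mono[OF B], simp add: Block_def)+
    moreover have "flip p \<in> affine_pts" using p(2) by simp
    ultimately show ?thesis
      using limit_orbit[OF a F fl p(2), of n "\<lambda>k. w (int k)" n]
        limit_orbit[OF a F, of flip "flip p" n "\<lambda>k. w (- int k)" n] by blast
  qed
  then show ?thesis using p(2) by (simp add: biitin_def itin_def)
qed

lemma bir_iter_orb:
  assumes "biitin a w p"
  shows "bir_iter a n p = orb a n p"
proof -
  have "(bir_inv a ^^ k) p = flip ((bir a ^^ k) (flip p))" for k
  proof (induction k)
    case (Suc k)
    have "determinate a ((bir a ^^ k) (flip p))" using assms by (simp add: biitin_def itin_def)
    then show ?case using Suc bir_inv_flip[of a "(bir a ^^ k) (flip p)"] by simp
  qed simp
  then show ?thesis by (simp add: bir_iter_def orb_def)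
qed

section \<open>Separation of points with different words\<close>

lemma compact_torus: "compact_space torus_top"
  by (simp add: torus_top_def compact_space_prod_topology)

lemma topspace_torus [simp]: "topspace torus_top = UNIV"
  by (simp only: torus_top_def topspace_prod_topology topspace_Alexandroff_compactification
      topspace_euclidean UNIV_option_conv[symmetric] UNIV_Times_UNIV)

lemma closedin_Rect: "closedin torus_top (Rect i)"
proof -
  have c: "closedin (Alexandroff_compactification euclideanreal) (insert None (Some ` S))" if "closed S" for S :: "real set"
  proof -
    have "insert None (Some ` S) = insert None (Some ` (UNIV :: real set)) - Some ` (- S)" by auto
    then show ?thesis using that by (auto simp: closedin_Alexandroff_compactification open_Compl)
  qed
  show ?thesis unfolding Rect_def torus_top_def
    by (cases "i = 0") (simp_all only: if_True if_False simp_thms closedin_prod_Times_iff c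
        closed_atLeast closed_atMost)
qed

lemma openin_near_infinity: "openin torus_top (near_infinity M)"
proof -
  have "{x. M < \<bar>x\<bar>} = UNIV - {-M..M}" by auto
  then have "openin (Alexandroff_compactification euclideanreal) (insert None (Some ` {x. M < \<bar>x\<bar>}))"
    unfolding openin_Alexandroff_compactification by (intro disjI2 exI[of _ "{-M..M}"]) auto
  then show ?thesis by (simp only: near_infinity_def torus_top_def openin_prod_Times_iff simp_thms)
qed

lemma Rect_inter: "p \<in> Rect 0 \<Longrightarrow> p \<in> Rect 1 \<Longrightarrow> p \<in> near_infinity M"
  by (cases p rule: torus_cases) (auto simp: Rect_def near_infinity_def)

text \<open>
  Take a Lebesgue number of the open cover by the complements of the two rectangles and the
  neighbourhood of \<open>(\<infinity>, \<infinity>)\<close>. A small ball containing points of both rectangles lies in the last set.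
\<close>

lemma Rect_separation:
  assumes d: "Metric_space UNIV d" and top: "Metric_space.mtopology UNIV d = torus_top"
  obtains e where "e > 0"
    "\<And>p q. p \<in> Rect 0 \<Longrightarrow> q \<in> Rect 1 \<Longrightarrow> d p q < e \<Longrightarrow> p \<in> near_infinity M \<and> q \<in> near_infinity M"
proof -
  interpret Metric_space UNIV d by fact
  let ?C = "{- Rect 0, - Rect 1, near_infinity M}"
  have "compactin mtopology UNIV" using compact_torus by (simp add: compact_space_def top)
  moreover have "UNIV \<subseteq> \<Union> ?C" using Rect_inter by auto
  moreover have "openin mtopology U" if "U \<in> ?C" for U
    using that closedin_Rect openin_near_infinity unfolding top
    by (auto simp: closedin_def Compl_eq_Diff_UNIV)
  ultimately obtain e where e: "e > 0" "\<forall>x\<in>UNIV. \<exists>U\<in>?C. mball x e \<subseteq> U"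
    using lebesgue_number[of UNIV ?C] by blast
  show ?thesis
  proof (rule that[OF e(1)])
    fix p q assume pq: "p \<in> Rect 0" "q \<in> Rect 1" "d p q < e"
    obtain U where U: "U \<in> ?C" "mball p e \<subseteq> U" using e(2) by blast
    have "p \<in> U" "q \<in> U" using U(2) pq e(1) by auto
    then show "p \<in> near_infinity M \<and> q \<in> near_infinity M" using U(1) pq by auto
  qed
qed

theorem theorem8p4:
  fixes a :: real and d :: "torus \<Rightarrow> torus \<Rightarrow> real"
  assumes "a < -1"
    and "Metric_space UNIV d"
    and "Metric_space.mtopology UNIV d = torus_top"
  shows "\<exists>\<eta>>0. \<forall>p \<in> Omega a \<inter> affine_pts. \<forall>q \<in> Omega a \<inter> affine_pts.
           p \<noteq> q \<longrightarrow> (SUP n::int. d (bir_iter a n p) (bir_iter a n q)) > \<eta>"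
proof -
  interpret Metric_space UNIV d by fact
  obtain e where e: "e > 0" "\<And>p q. p \<in> Rect 0 \<Longrightarrow> q \<in> Rect 1 \<Longrightarrow> d p q < e
      \<Longrightarrow> p \<in> near_infinity (- a) \<and> q \<in> near_infinity (- a)"
    using Rect_separation[OF assms(2,3)] by blast
  have "mbounded UNIV" using compactin_imp_mbounded compact_torus by (simp add: compact_space_def assms(3))
  then obtain B where B: "\<And>p q. d p q \<le> B" unfolding mbounded_alt by auto
  show ?thesis
  proof (intro exI[of _ "e / 2"] conjI ballI impI)
    show "e / 2 > 0" using e by simp
    fix p q assume p: "p \<in> Omega a \<inter> affine_pts" and q: "q \<in> Omega a \<inter> affine_pts" and ne: "p \<noteq> q"
    obtain w where w: "w \<in> words" "biitin a w p" using p Rect_word_biitin[OF assms(1)] unfolding Omega_def by blast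
    obtain w' where w': "w' \<in> words" "biitin a w' q" using q Rect_word_biitin[OF assms(1)] unfolding Omega_def by blast
    show "(SUP n::int. d (bir_iter a n p) (bir_iter a n q)) > e / 2"
    proof (rule ccontr)
      assume "\<not> ?thesis"
      moreover have "d (bir_iter a n p) (bir_iter a n q) \<le> (SUP n::int. d (bir_iter a n p) (bir_iter a n q))" for n
        using B by (intro cSUP_upper bdd_aboveI2[of _ _ B]) auto
      ultimately have "d (bir_iter a n p) (bir_iter a n q) \<le> e / 2" for n by (meson not_le order_trans)
      then have small: "d (orb a n p) (orb a n q) < e" for n
        using e(1) bir_iter_orb[OF w(2)] bir_iter_orb[OF w'(2)] by (smt (verit) field_sum_of_halves)
      have "w \<noteq> w'" using affine_word_unique[OF assms(1) w(1,2)] w'(2) ne by blast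
      then obtain k where k: "w k \<noteq> w' k" by auto
      have "orb a n p \<in> near_infinity (- a) \<and> orb a n q \<in> near_infinity (- a)" if ne: "w n \<noteq> w' n" for n
      proof -
        consider "w n = 0" "w' n = 1" | "w n = 1" "w' n = 0"
          using words_values[OF w(1), of n] words_values[OF w'(1), of n] ne by auto
        then show ?thesis
          using e(2)[of "orb a n p" "orb a n q"] e(2)[of "orb a n q" "orb a n p"] small[of n]
            orb_Rect[OF w(2), of n] orb_Rect[OF w'(2), of n] commute[of "orb a n p" "orb a n q"]
          by cases auto
      qed
      then show False using not_always_near_infinity[OF assms(1) w(1) w'(1) w(2) w'(2) k] by blast
    qed
  qed
qed

end
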